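(* Let $F:(N^n,g_N)\to(B^b,\varphi,\xi,\eta,g_B)$ be a Clairaut anti-invariant Riemannian map with $r=e^f$, where $f$ is a smooth function on $B$, from a Riemannian manifold $N$ to a Sasakian manifold $B$, such that the Reeb vector field $\xi$ lies in $(\mathrm{range}F_* )^\perp$ and $(\mathrm{range}F_* )^\perp$ is a totally geodesic distribution of $TB$. Then at least one of the following statements is true: (i) $\dim(\mathrm{range}F_* )=1$; (ii) $f$ is constant on $\varphi(\mathrm{range}F_* )$.
   Context: A Sasakian manifold $(B,\varphi,\xi,\eta,g_B)$ is an odd-dimensional Riemannian manifold with a $(1,1)$-tensor $\varphi$, a vector field $\xi$ (Reeb field) and a 1-form $\eta$ satisfying $\varphi^2=-I+\eta\otimes\xi$, $\varphi\xi=0$, $\eta\circ\varphi=0$, $\eta(\xi)=1$, $g_B(\varphi U,\varphi V)=g_B(U,V)-\eta(U)\eta(V)$, $g_B(\varphi U,V)=-g_B(U,\varphi V)$, $\eta(U)=g_B(U,\xi)$, and, with $\nabla^B$ the Levi-Civita connection of $g_B$, $(\nabla^B_U\varphi)V=g_B(U,V)\xi-\eta(V)U$ and $\nabla^B_U\xi=-\varphi U$. A Riemannian map is a smooth map $F:(N^n,g_N)\to(B^b,g_B)$ of constant rank with $0<\mathrm{rank}F<\min\{n,b\}$ such that $F_*$ restricts to an isometry from $(\ker F_* )^\perp$ onto $\mathrm{range}F_*$ at each point. $F$ is anti-invariant if $\varphi(\mathrm{range}F_{*y})\subset(\mathrm{range}F_{*y})^\perp$ for every $y\in N$. The distribution $(\mathrm{range}F_*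 )^\perp$ is totally geodesic if $\nabla^B_ZV\in\Gamma(\mathrm{range}F_* )^\perp$ for all $Z,V\in\Gamma(\mathrm{range}F_* )^\perp$. An anti-invariant Riemannian map $F$ from a Riemannian manifold to a Sasakian manifold is a Clairaut anti-invariant Riemannian map if there is a function $r:B\to\mathbb{R}^+$ such that for every geodesic $\sigma$ on $B$ the function $(r\circ\sigma)\sin\theta(t)$ is constant, where $F_*Y_1\in\Gamma(\mathrm{range}F_* )$ and $Z\in\Gamma(\mathrm{range}F_* )^\perp$ are the components of $\dot\sigma(t)$ and $\theta(t)$ is the angle between $\dot\sigma(t)$ and $Z$. For Riemannian maps, with $\gamma$ and $\sigma=F\circ\gamma$ geodesics on $N$ and $B$, the following known characterization (Meena–Yadav) of "Clairaut with $r=e^f$" is taken as given: $F$ is umbilical, i.e. $(\nabla F_* )(X,Y)=g_N(X,Y)H_B$ for $X,Y\in\Gamma(\ker F_* )^\perp$, with mean curvature vector field $H_B=-\nabla^Bf$ (minus the gradient of $f$). Here $(\nabla F_* )(X,Y)=\overset{B}{\nabla^F_X}F_*Y-F_*(\nabla^N_XY)$ with $\overset{B}{\nabla^F}$ the pullback connection and $\nabla^N$ the Levi-Civita connection of $g_N$. "$f$ is constant on $\varphi(\mathrm{range}F_* )$" means $g_B(\nabla^Bf,\varphi F_*X)=0$ for all $F_*X\in\Gamma(\mathrm{range}F_* )$. *)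

theory Defs
  imports "HOL-Analysis.Analysis"
begin

text \<open>Smoothness; only meant for open \<open>S\<close>, where derivatives within \<open>S\<close> and at points of \<open>S\<close> agree.\<close>

primrec Ck_on :: "nat \<Rightarrow> 'a::real_normed_vector set \<Rightarrow> ('a \<Rightarrow> 'b::real_normed_vector) \<Rightarrow> bool" where
  "Ck_on 0 S f \<longleftrightarrow> continuous_on S f"
| "Ck_on (Suc k) S f \<longleftrightarrow>
     f differentiable_on S \<and> (\<forall>v. Ck_on k S (\<lambda>x. frechet_derivative f (at x) v))"

definition smooth_on :: "'a::real_normed_vector set \<Rightarrow> ('a \<Rightarrow> 'b::real_normed_vector) \<Rightarrow> bool" where
  "smooth_on S f \<longleftrightarrow> (\<forall>k. Ck_on k S f)"

text \<open>
  A manifold is a second countable Hausdorff type \<open>'m\<close> together with a smooth atlas modelled on a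
  Euclidean space \<open>'e\<close>; its dimension is \<open>DIM('e)\<close>. A chart is its domain paired with its
  coordinate map. The coordinate map is only relevant on the domain.
\<close>

type_synonym ('m, 'e) chart = "'m set \<times> ('m \<Rightarrow> 'e)"

definition chart_inv :: "('m, 'e) chart \<Rightarrow> 'e \<Rightarrow> 'm" where
  "chart_inv c = inv_into (fst c) (snd c)"

definition smooth_atlas ::
  "('m::{t2_space,second_countable_topology}, 'e::euclidean_space) chart set \<Rightarrow> bool" where
  "smooth_atlas A \<longleftrightarrow>
     (\<forall>c\<in>A. open (fst c) \<and> open (snd c ` fst c) \<and>
            homeomorphism (fst c) (snd c ` fst c) (snd c) (chart_inv c)) \<and>
     (\<Union>c\<in>A. fst c) = UNIV \<and>
     (\<forall>c\<in>A. \<forall>d\<in>A. smooth_on (snd c ` (fst c \<inter> fst d)) (snd d \<circ> chart_inv c))"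

definition std_atlas :: "('e, 'e) chart set" where
  "std_atlas = {(UNIV, \<lambda>x. x)}"

text \<open>
  The tangent space at \<open>p\<close> is identified with \<open>'e\<close> through a chart chosen once and for all at
  \<open>p\<close>: the vector \<open>u :: 'e\<close> stands for the tangent vector whose components in \<open>chart_at A p\<close> are
  \<open>u\<close>. Since the chosen chart varies with \<open>p\<close> without any continuity, smoothness of fields is always
  expressed through the components \<open>to_chart\<close> in a fixed chart.
\<close>

definition chart_at :: "('m, 'e) chart set \<Rightarrow> 'm \<Rightarrow> ('m, 'e) chart" where
  "chart_at A p = (SOME c. c \<in> A \<and> p \<in> fst c)"

definition to_chart ::
  "('m, 'e::real_normed_vector) chart set \<Rightarrow> ('m, 'e) chart \<Rightarrow> 'm \<Rightarrow> 'e \<Rightarrow> 'e" where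
  "to_chart A c p u =
     frechet_derivative (\<lambda>x. snd c (chart_inv (chart_at A p) x)) (at (snd (chart_at A p) p)) u"

text \<open>The field on the domain of \<open>c\<close> with constant components \<open>a\<close> in the chart \<open>c\<close>.\<close>

definition coord_field ::
  "('m, 'e::real_normed_vector) chart set \<Rightarrow> ('m, 'e) chart \<Rightarrow> 'e \<Rightarrow> 'm \<Rightarrow> 'e" where
  "coord_field A c a p =
     frechet_derivative (\<lambda>x. snd (chart_at A p) (chart_inv c x)) (at (snd c p)) a"

definition smooth_map_on ::
  "('m::topological_space, 'e::real_normed_vector) chart set \<Rightarrow>
   ('m'::topological_space, 'e'::real_normed_vector) chart set \<Rightarrow> 'm set \<Rightarrow> ('m \<Rightarrow> 'm') \<Rightarrow> bool" where
  "smooth_map_on A A' U F \<longleftrightarrow>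
     continuous_on U F \<and>
     (\<forall>c\<in>A. \<forall>d\<in>A'. smooth_on (snd c ` (U \<inter> fst c \<inter> F -` fst d)) (snd d \<circ> F \<circ> chart_inv c))"

definition mderiv ::
  "('m, 'e::real_normed_vector) chart set \<Rightarrow> ('m', 'e'::real_normed_vector) chart set \<Rightarrow>
   ('m \<Rightarrow> 'm') \<Rightarrow> 'm \<Rightarrow> 'e \<Rightarrow> 'e'" where
  "mderiv A A' F p u =
     frechet_derivative (\<lambda>x. snd (chart_at A' (F p)) (F (chart_inv (chart_at A p) x)))
       (at (snd (chart_at A p) p)) u"

abbreviation smooth_fun_on ::
  "('m::topological_space, 'e::real_normed_vector) chart set \<Rightarrow> 'm set \<Rightarrow> ('m \<Rightarrow> real) \<Rightarrow> bool" where
  "smooth_fun_on A U f \<equiv> smooth_map_on A std_atlas U f"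

abbreviation dfun ::
  "('m, 'e::real_normed_vector) chart set \<Rightarrow> ('m \<Rightarrow> real) \<Rightarrow> 'm \<Rightarrow> 'e \<Rightarrow> real" where
  "dfun A f p u \<equiv> mderiv A std_atlas f p u"

definition smooth_field_on ::
  "('m, 'e::real_normed_vector) chart set \<Rightarrow> 'm set \<Rightarrow> ('m \<Rightarrow> 'e) \<Rightarrow> bool" where
  "smooth_field_on A U V \<longleftrightarrow>
     (\<forall>c\<in>A. smooth_on (snd c ` (U \<inter> fst c)) (\<lambda>x. to_chart A c (chart_inv c x) (V (chart_inv c x))))"

definition lie_bracket ::
  "('m, 'e::real_normed_vector) chart set \<Rightarrow> ('m \<Rightarrow> 'e) \<Rightarrow> ('m \<Rightarrow> 'e) \<Rightarrow> 'm \<Rightarrow> 'e" where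
  "lie_bracket A X Y p =
     (let c = chart_at A p;
          comps = (\<lambda>V x. to_chart A c (chart_inv c x) (V (chart_inv c x)))
      in frechet_derivative (comps Y) (at (snd c p)) (X p)
       - frechet_derivative (comps X) (at (snd c p)) (Y p))"

text \<open>
  Sections of the tangent bundle and of distributions are taken over arbitrary open sets \<open>U\<close>; a
  section over \<open>U\<close> is a total function whose values outside \<open>U\<close> are irrelevant.
\<close>

definition riemannian_metric ::
  "('m::topological_space, 'e::euclidean_space) chart set \<Rightarrow> ('m \<Rightarrow> 'e \<Rightarrow> 'e \<Rightarrow> real) \<Rightarrow> bool" where
  "riemannian_metric A g \<longleftrightarrow>
     (\<forall>p. bilinear (g p) \<and> (\<forall>u v. g p u v = g p v u) \<and> (\<forall>u. u \<noteq> 0 \<longrightarrow> g p u u > 0)) \<and>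
     (\<forall>U X Y. open U \<and> smooth_field_on A U X \<and> smooth_field_on A U Y \<longrightarrow>
        smooth_fun_on A U (\<lambda>p. g p (X p) (Y p)))"

definition orth :: "('m \<Rightarrow> 'e \<Rightarrow> 'e \<Rightarrow> real) \<Rightarrow> 'm \<Rightarrow> 'e set \<Rightarrow> 'e set" where
  "orth g p S = {v. \<forall>w\<in>S. g p v w = 0}"

definition grad ::
  "('m, 'e::euclidean_space) chart set \<Rightarrow> ('m \<Rightarrow> 'e \<Rightarrow> 'e \<Rightarrow> real) \<Rightarrow> ('m \<Rightarrow> real) \<Rightarrow> 'm \<Rightarrow> 'e" where
  "grad A g f p = (THE w. \<forall>v. g p w v = dfun A f p v)"

text \<open>\<open>nabla p u V\<close> is the covariant derivative at \<open>p\<close> of the field \<open>V\<close> in direction \<open>u\<close>.\<close>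

type_synonym ('m, 'e) cov = "'m \<Rightarrow> 'e \<Rightarrow> ('m \<Rightarrow> 'e) \<Rightarrow> 'e"

definition affine_connection ::
  "('m::topological_space, 'e::euclidean_space) chart set \<Rightarrow> ('m, 'e) cov \<Rightarrow> bool" where
  "affine_connection A nabla \<longleftrightarrow>
     (\<forall>U V p. open U \<and> p \<in> U \<and> smooth_field_on A U V \<longrightarrow> linear (\<lambda>u. nabla p u V)) \<and>
     (\<forall>U V W p u. open U \<and> p \<in> U \<and> smooth_field_on A U V \<and> smooth_field_on A U W \<longrightarrow>
        nabla p u (\<lambda>q. V q + W q) = nabla p u V + nabla p u W) \<and>
     (\<forall>U h V p u. open U \<and> p \<in> U \<and> smooth_fun_on A U h \<and> smooth_field_on A U V \<longrightarrow>
        nabla p u (\<lambda>q. h q *\<^sub>R V q) = dfun A h p u *\<^sub>R V p + h p *\<^sub>R nabla p u V) \<and>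
     (\<forall>U V W p u. open U \<and> p \<in> U \<and> smooth_field_on A U V \<and> smooth_field_on A U W \<and>
        (\<forall>q\<in>U. V q = W q) \<longrightarrow> nabla p u V = nabla p u W) \<and>
     (\<forall>U X V. open U \<and> smooth_field_on A U X \<and> smooth_field_on A U V \<longrightarrow>
        smooth_field_on A U (\<lambda>p. nabla p (X p) V))"

definition levi_civita ::
  "('m::topological_space, 'e::euclidean_space) chart set \<Rightarrow> ('m \<Rightarrow> 'e \<Rightarrow> 'e \<Rightarrow> real) \<Rightarrow>
   ('m, 'e) cov \<Rightarrow> bool" where
  "levi_civita A g nabla \<longleftrightarrow>
     affine_connection A nabla \<and>
     (\<forall>U X Y p. open U \<and> p \<in> U \<and> smooth_field_on A U X \<and> smooth_field_on A U Y \<longrightarrow>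
        nabla p (X p) Y - nabla p (Y p) X = lie_bracket A X Y p) \<and>
     (\<forall>U X Y p u. open U \<and> p \<in> U \<and> smooth_field_on A U X \<and> smooth_field_on A U Y \<longrightarrow>
        dfun A (\<lambda>q. g q (X q) (Y q)) p u = g p (nabla p u X) (Y p) + g p (X p) (nabla p u Y))"

definition riemannian_manifold ::
  "('m::{t2_space,second_countable_topology}, 'e::euclidean_space) chart set \<Rightarrow>
   ('m \<Rightarrow> 'e \<Rightarrow> 'e \<Rightarrow> real) \<Rightarrow> ('m, 'e) cov \<Rightarrow> bool" where
  "riemannian_manifold A g nabla \<longleftrightarrow>
     smooth_atlas A \<and> riemannian_metric A g \<and> levi_civita A g nabla"

text \<open>
  The pullback connection along \<open>F\<close>, applied to a field \<open>W\<close> along \<open>F\<close>. Near \<open>p\<close>, in the chart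
  \<open>d\<close> at \<open>F p\<close> with coordinate frame \<open>E\<^sub>i\<close>, one has \<open>W = \<Sum>\<^sub>i w\<^sub>i (E\<^sub>i \<circ> F)\<close>, so that
  the derivative of \<open>W\<close> along \<open>u\<close> is \<open>\<Sum>\<^sub>i u(w\<^sub>i) E\<^sub>i + w\<^sub>i(p) nabla (F p) (F\<^sub>* u) E\<^sub>i\<close>. The first summand is the derivative of the components of
  \<open>W\<close>, the second one is the derivative of the coordinate field with components those of \<open>W p\<close>.
\<close>

definition pullback_cov ::
  "('m, 'e::real_normed_vector) chart set \<Rightarrow> ('m', 'e'::euclidean_space) chart set \<Rightarrow>
   ('m', 'e') cov \<Rightarrow> ('m \<Rightarrow> 'm') \<Rightarrow> 'm \<Rightarrow> 'e \<Rightarrow> ('m \<Rightarrow> 'e') \<Rightarrow> 'e'" where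
  "pullback_cov A A' nabla F p u W =
     (let c = chart_at A p; d = chart_at A' (F p)
      in frechet_derivative
           (\<lambda>x. to_chart A' d (F (chart_inv c x)) (W (chart_inv c x))) (at (snd c p)) u
         + nabla (F p) (mderiv A A' F p u) (coord_field A' d (W p)))"

abbreviation velocity :: "('m, 'e::real_normed_vector) chart set \<Rightarrow> (real \<Rightarrow> 'm) \<Rightarrow> real \<Rightarrow> 'e" where
  "velocity A \<sigma> t \<equiv> mderiv (std_atlas :: (real, real) chart set) A \<sigma> t 1"

definition geodesic_on ::
  "('m::topological_space, 'e::euclidean_space) chart set \<Rightarrow> ('m, 'e) cov \<Rightarrow> real set \<Rightarrow>
   (real \<Rightarrow> 'm) \<Rightarrow> bool" where
  "geodesic_on A nabla I \<sigma> \<longleftrightarrow>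
     smooth_map_on (std_atlas :: (real, real) chart set) A I \<sigma> \<and>
     (\<forall>t\<in>I. pullback_cov (std_atlas :: (real, real) chart set) A nabla \<sigma> t 1 (velocity A \<sigma>) = 0)"

text \<open>
  A zero vector is at angle \<open>\<pi>/2\<close> with every vector. Thus, if \<open>Z\<close> is an orthogonal component of
  \<open>u \<noteq> 0\<close>, the cosine of the angle between \<open>u\<close> and \<open>Z\<close> is \<open>|Z|/|u|\<close> also for \<open>Z = 0\<close>.
\<close>

definition metric_angle :: "('m \<Rightarrow> 'e::zero \<Rightarrow> 'e \<Rightarrow> real) \<Rightarrow> 'm \<Rightarrow> 'e \<Rightarrow> 'e \<Rightarrow> real" where
  "metric_angle g p u v =
     (if u = 0 \<or> v = 0 then pi / 2 else arccos (g p u v / (sqrt (g p u u) * sqrt (g p v v))))"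

definition sasakian_manifold ::
  "('m::{t2_space,second_countable_topology}, 'e::euclidean_space) chart set \<Rightarrow>
   ('m \<Rightarrow> 'e \<Rightarrow> 'e) \<Rightarrow> ('m \<Rightarrow> 'e) \<Rightarrow> ('m \<Rightarrow> 'e \<Rightarrow> real) \<Rightarrow> ('m \<Rightarrow> 'e \<Rightarrow> 'e \<Rightarrow> real) \<Rightarrow>
   ('m, 'e) cov \<Rightarrow> bool" where
  "sasakian_manifold A \<phi> \<xi> \<eta> g nabla \<longleftrightarrow>
     odd DIM('e) \<and> riemannian_manifold A g nabla \<and>
     (\<forall>p. linear (\<phi> p)) \<and> (\<forall>p. linear (\<eta> p)) \<and>
     (\<forall>U V. open U \<and> smooth_field_on A U V \<longrightarrow> smooth_field_on A U (\<lambda>p. \<phi> p (V p))) \<and>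
     (\<forall>U V. open U \<and> smooth_field_on A U V \<longrightarrow> smooth_fun_on A U (\<lambda>p. \<eta> p (V p))) \<and>
     smooth_field_on A UNIV \<xi> \<and>
     (\<forall>p u. \<phi> p (\<phi> p u) = - u + \<eta> p u *\<^sub>R \<xi> p) \<and>
     (\<forall>p. \<phi> p (\<xi> p) = 0) \<and>
     (\<forall>p u. \<eta> p (\<phi> p u) = 0) \<and>
     (\<forall>p. \<eta> p (\<xi> p) = 1) \<and>
     (\<forall>p u v. g p (\<phi> p u) (\<phi> p v) = g p u v - \<eta> p u * \<eta> p v) \<and>
     (\<forall>p u v. g p (\<phi> p u) v = - g p u (\<phi> p v)) \<and>
     (\<forall>p u. \<eta> p u = g p u (\<xi> p)) \<and>
     (\<forall>U V p u. open U \<and> p \<in> U \<and> smooth_field_on A U V \<longrightarrow>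
        nabla p u (\<lambda>q. \<phi> q (V q)) - \<phi> p (nabla p u V) = g p u (V p) *\<^sub>R \<xi> p - \<eta> p (V p) *\<^sub>R u) \<and>
     (\<forall>p u. nabla p u \<xi> = - \<phi> p u)"

abbreviation range_at ::
  "('n, 'e::euclidean_space) chart set \<Rightarrow> ('b, 'h::euclidean_space) chart set \<Rightarrow>
   ('n \<Rightarrow> 'b) \<Rightarrow> 'n \<Rightarrow> 'h set" where
  "range_at A A' F p \<equiv> range (mderiv A A' F p)"

definition horizontal ::
  "('n, 'e::euclidean_space) chart set \<Rightarrow> ('b, 'h::euclidean_space) chart set \<Rightarrow>
   ('n \<Rightarrow> 'e \<Rightarrow> 'e \<Rightarrow> real) \<Rightarrow> ('n \<Rightarrow> 'b) \<Rightarrow> 'n \<Rightarrow> 'e set" where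
  "horizontal A A' g F p = orth g p {u. mderiv A A' F p u = 0}"

definition riemannian_map ::
  "('n::topological_space, 'e::euclidean_space) chart set \<Rightarrow> ('n \<Rightarrow> 'e \<Rightarrow> 'e \<Rightarrow> real) \<Rightarrow>
   ('b::topological_space, 'h::euclidean_space) chart set \<Rightarrow> ('b \<Rightarrow> 'h \<Rightarrow> 'h \<Rightarrow> real) \<Rightarrow>
   ('n \<Rightarrow> 'b) \<Rightarrow> bool" where
  "riemannian_map A g A' g' F \<longleftrightarrow>
     smooth_map_on A A' UNIV F \<and>
     (\<exists>k. 0 < k \<and> k < min DIM('e) DIM('h) \<and> (\<forall>p. dim (range_at A A' F p) = k)) \<and>
     (\<forall>p. mderiv A A' F p ` horizontal A A' g F p = range_at A A' F p \<and>
          (\<forall>u\<in>horizontal A A' g F p. \<forall>v\<in>horizontal A A' g F p.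
             g' (F p) (mderiv A A' F p u) (mderiv A A' F p v) = g p u v))"

definition anti_invariant ::
  "('n, 'e::euclidean_space) chart set \<Rightarrow> ('b, 'h::euclidean_space) chart set \<Rightarrow>
   ('b \<Rightarrow> 'h \<Rightarrow> 'h) \<Rightarrow> ('b \<Rightarrow> 'h \<Rightarrow> 'h \<Rightarrow> real) \<Rightarrow> ('n \<Rightarrow> 'b) \<Rightarrow> bool" where
  "anti_invariant A A' \<phi> g' F \<longleftrightarrow>
     (\<forall>p. \<phi> (F p) ` range_at A A' F p \<subseteq> orth g' (F p) (range_at A A' F p))"

definition second_fundamental_form ::
  "('n, 'e::euclidean_space) chart set \<Rightarrow> ('n, 'e) cov \<Rightarrow>
   ('b, 'h::euclidean_space) chart set \<Rightarrow> ('b, 'h) cov \<Rightarrow>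
   ('n \<Rightarrow> 'b) \<Rightarrow> ('n \<Rightarrow> 'e) \<Rightarrow> ('n \<Rightarrow> 'e) \<Rightarrow> 'n \<Rightarrow> 'h" where
  "second_fundamental_form A nabla A' nabla' F X Y p =
     pullback_cov A A' nabla' F p (X p) (\<lambda>q. mderiv A A' F q (Y q))
     - mderiv A A' F p (nabla p (X p) Y)"

text \<open>\<open>H\<close> is the mean curvature vector field, a field along \<open>F\<close>.\<close>

definition umbilical_map ::
  "('n::topological_space, 'e::euclidean_space) chart set \<Rightarrow> ('n \<Rightarrow> 'e \<Rightarrow> 'e \<Rightarrow> real) \<Rightarrow>
   ('n, 'e) cov \<Rightarrow> ('b, 'h::euclidean_space) chart set \<Rightarrow> ('b, 'h) cov \<Rightarrow>
   ('n \<Rightarrow> 'b) \<Rightarrow> ('n \<Rightarrow> 'h) \<Rightarrow> bool" where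
  "umbilical_map A g nabla A' nabla' F H \<longleftrightarrow>
     (\<forall>U X Y. open U \<and> smooth_field_on A U X \<and> smooth_field_on A U Y \<and>
        (\<forall>p\<in>U. X p \<in> horizontal A A' g F p \<and> Y p \<in> horizontal A A' g F p) \<longrightarrow>
        (\<forall>p\<in>U. second_fundamental_form A nabla A' nabla' F X Y p = g p (X p) (Y p) *\<^sub>R H p))"

text \<open>
  The decomposition of the velocity of a geodesic \<open>\<sigma>\<close> of the target into its components \<open>T\<close> in
  \<open>range F\<^sub>*\<close> and \<open>Z\<close> in the orthogonal complement makes sense where \<open>\<sigma>\<close> is given as \<open>F \<circ> \<gamma>\<close>, the
  distribution being taken at \<open>\<gamma> t\<close>.
\<close>

definition clairaut_map ::
  "('n::topological_space, 'e::euclidean_space) chart set \<Rightarrow>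
   ('b::topological_space, 'h::euclidean_space) chart set \<Rightarrow> ('b \<Rightarrow> 'h \<Rightarrow> 'h \<Rightarrow> real) \<Rightarrow>
   ('b, 'h) cov \<Rightarrow> ('n \<Rightarrow> 'b) \<Rightarrow> ('b \<Rightarrow> real) \<Rightarrow> bool" where
  "clairaut_map A A' g' nabla' F r \<longleftrightarrow>
     (\<forall>b. 0 < r b) \<and>
     (\<forall>I \<gamma> \<sigma> T Z.
        open I \<and> is_interval I \<and>
        smooth_map_on (std_atlas :: (real, real) chart set) A I \<gamma> \<and>
        \<sigma> = F \<circ> \<gamma> \<and> geodesic_on A' nabla' I \<sigma> \<and>
        (\<forall>t\<in>I. T t \<in> range_at A A' F (\<gamma> t) \<and>
               Z t \<in> orth g' (\<sigma> t) (range_at A A' F (\<gamma> t)) \<and>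
               velocity A' \<sigma> t = T t + Z t) \<longrightarrow>
        (\<exists>C. \<forall>t\<in>I. r (\<sigma> t) * sin (metric_angle g' (\<sigma> t) (velocity A' \<sigma> t) (Z t)) = C))"

definition smooth_distribution_on ::
  "('m::topological_space, 'e::euclidean_space) chart set \<Rightarrow> 'm set \<Rightarrow> nat \<Rightarrow> ('m \<Rightarrow> 'e set) \<Rightarrow> bool" where
  "smooth_distribution_on A W k D \<longleftrightarrow>
     open W \<and>
     (\<forall>p\<in>W. \<exists>U E. open U \<and> p \<in> U \<and> U \<subseteq> W \<and> (\<forall>i<k. smooth_field_on A U (E i)) \<and>
        (\<forall>q\<in>U. D q = span ((\<lambda>i. E i q) ` {..<k}) \<and> dim (D q) = k))"

definition totally_geodesic_on ::
  "('m::topological_space, 'e::euclidean_space) chart set \<Rightarrow> ('m, 'e) cov \<Rightarrow> 'm set \<Rightarrow>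
   ('m \<Rightarrow> 'e set) \<Rightarrow> bool" where
  "totally_geodesic_on A nabla W D \<longleftrightarrow>
     (\<forall>U Z V. open U \<and> U \<subseteq> W \<and> smooth_field_on A U Z \<and> smooth_field_on A U V \<and>
        (\<forall>q\<in>U. Z q \<in> D q \<and> V q \<in> D q) \<longrightarrow> (\<forall>q\<in>U. nabla q (Z q) V \<in> D q))"

text \<open>
  The spaces orthogonal to \<open>range F\<^sub>*\<close> are only given along \<open>F\<close>, and differentiating in directions
  transversal to the image needs them nearby. They are therefore understood, locally, as the
  restriction along \<open>F\<close> of a smooth distribution \<open>D\<close> on an open set of the target. Allowing arbitrary
  extensions of the sections instead of sections of such a \<open>D\<close> would make the condition
  unsatisfiable (multiply a field tangent to the image by a function vanishing on the image).
\<close>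

definition totally_geodesic_normal ::
  "('n::topological_space, 'e::euclidean_space) chart set \<Rightarrow>
   ('b::topological_space, 'h::euclidean_space) chart set \<Rightarrow> ('b \<Rightarrow> 'h \<Rightarrow> 'h \<Rightarrow> real) \<Rightarrow>
   ('b, 'h) cov \<Rightarrow> ('n \<Rightarrow> 'b) \<Rightarrow> bool" where
  "totally_geodesic_normal A A' g' nabla' F \<longleftrightarrow>
     (\<forall>p. \<exists>U W k D. open U \<and> p \<in> U \<and> F ` U \<subseteq> W \<and>
        smooth_distribution_on A' W k D \<and>
        (\<forall>q\<in>U. D (F q) = orth g' (F q) (range_at A A' F q)) \<and>
        totally_geodesic_on A' nabla' W D)"

end

theory Submission
  imports Defs
begin

text \<open>
  The proof differentiates a single identity. Write \<open>\<Omega> v w = g\<^sub>B (\<phi> v) w\<close> for the fundamental 2-form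
  of the Sasakian manifold. Anti-invariance says that \<open>\<Omega>\<close> vanishes on \<open>range F\<^sub>*\<close>, so that
  \<open>\<Omega> (F\<^sub>* Y) (F\<^sub>* X) = 0\<close> for all fields \<open>X\<close>, \<open>Y\<close> on the source. The Sasakian formula for the derivative
  of \<open>\<phi>\<close> gives \<open>(\<nabla>\<^sub>U \<Omega>) V W = g\<^sub>B U V * \<eta> W - \<eta> V * g\<^sub>B U W\<close>, which vanishes on \<open>range F\<^sub>*\<close>
  because \<open>\<xi>\<close> is normal to it. Differentiating the identity along \<open>F\<close> in the direction \<open>X\<close> thus
  leaves \<open>\<Omega> (\<nabla>\<^sub>X F\<^sub>* Y) (F\<^sub>* X) + \<Omega> (F\<^sub>* Y) (\<nabla>\<^sub>X F\<^sub>* X) = 0\<close>, with the pullback connection.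

  For horizontal \<open>X\<close>, \<open>Y\<close> the umbilicity of \<open>F\<close> turns \<open>\<nabla>\<^sub>X F\<^sub>* Y\<close> into a vector of \<open>range F\<^sub>*\<close>, which
  \<open>\<Omega>\<close> does not see, plus \<open>g\<^sub>N X Y *\<^sub>R H\<close>. If \<open>X\<close> and \<open>Y\<close> are orthogonal at the point considered, what
  remains is \<open>g\<^sub>N X X * g\<^sub>B (\<phi> (F\<^sub>* Y)) H = 0\<close> with \<open>H = - grad f\<close>. As soon as the rank is at least two,
  every \<open>F\<^sub>* Y\<close> has a nonzero orthogonal companion \<open>F\<^sub>* X\<close> in the range, and \<open>f\<close> is constant on
  \<open>\<phi> (range F\<^sub>*)\<close>. This is \<open>orthogonal_range_vectors\<close>.

  Two points need work. Umbilicity speaks about smooth horizontal fields, so every horizontal vector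
  has to be extended to one; \<open>horizontal_extension\<close> does this with the pointwise adjoint of \<open>F\<^sub>*\<close>, whose
  values are automatically horizontal. And the product rule for \<open>\<Omega>\<close> along \<open>F\<close> is needed for fields that
  only live along \<open>F\<close>; \<open>fundamental_form_has_derivative_along\<close> obtains it by expanding these fields in a
  coordinate frame, to which the axioms of the connection apply. Both rest on some calculus of smooth
  functions and on the chain rule in charts.
\<close>

section \<open>Calculus of smooth functions\<close>

lemma differentiable_at_of_Ck_on:
  assumes "Ck_on (Suc k) S f" "open S" "x \<in> S"
  shows "f differentiable (at x)"
  using assms differentiable_on_eq_differentiable_at by auto

lemma Ck_on_subset:
  assumes "T \<subseteq> S"
  shows "Ck_on k S f \<Longrightarrow> Ck_on k T f"
proof (induction k arbitrary: f)
  case 0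
  then show ?case using continuous_on_subset[of S f T] assms by simp
next
  case (Suc k)
  then show ?case using differentiable_on_subset[of f S T] assms by simp
qed

lemma Ck_on_cong:
  assumes "open S" "\<And>x. x \<in> S \<Longrightarrow> f x = g x"
  shows "Ck_on k S f \<longleftrightarrow> Ck_on k S g"
  using assms(2)
proof (induction k arbitrary: f g)
  case 0
  then show ?case using continuous_on_cong by simp
next
  case (Suc k)
  have *: "f differentiable_on S \<longleftrightarrow> g differentiable_on S"
    using Suc.prems differentiable_transform_within[OF _ zero_less_one]
    unfolding differentiable_on_def by metis
  { assume d: "f differentiable_on S"
    have "frechet_derivative f (at x) v = frechet_derivative g (at x) v" if "x \<in> S" for x v
    proof -
      have "f differentiable (at x)"
        using d that assms(1) differentiable_on_eq_differentiable_at by blast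
      then show ?thesis
        using frechet_derivative_transform_within_open[OF _ assms(1) that] Suc.prems by metis
    qed
    then have "(\<forall>v. Ck_on k S (\<lambda>x. frechet_derivative f (at x) v)) \<longleftrightarrow>
        (\<forall>v. Ck_on k S (\<lambda>x. frechet_derivative g (at x) v))"
      using Suc.IH by meson }
  then show ?case using * by auto
qed

lemma Ck_on_Suc_imp: "Ck_on (Suc k) S f \<Longrightarrow> Ck_on k S f"
proof (induction k arbitrary: f)
  case 0
  then show ?case using differentiable_imp_continuous_on by auto
next
  case (Suc k)
  then show ?case by (metis Ck_on.simps(2))
qed

lemma Ck_on_derivative: "Ck_on (Suc k) S f \<Longrightarrow> Ck_on k S (\<lambda>x. frechet_derivative f (at x) v)"
  by simp

text \<open>
  The closure properties below go by induction on the order: the derivative of a sum, product, inverse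
  or composition is again built by these operations from functions with one derivative less, and this
  introduction rule lets the derivative be given by its usual formula.
\<close>

lemma Ck_on_SucI:
  assumes "open S" "\<And>x. x \<in> S \<Longrightarrow> (f has_derivative f' x) (at x)"
    and "\<And>v. Ck_on k S (\<lambda>x. f' x v)"
  shows "Ck_on (Suc k) S f"
proof -
  have "f differentiable_on S"
    using assms(1,2) differentiable_on_eq_differentiable_at differentiableI by blast
  moreover have "frechet_derivative f (at x) v = f' x v" if "x \<in> S" for x v
    using frechet_derivative_at[OF assms(2)[OF that]] by simp
  ultimately show ?thesis using assms(3)
    Ck_on_cong[OF assms(1), of "\<lambda>x. frechet_derivative f (at x) v" "\<lambda>x. f' x v" for v] by simp
qed

lemma has_derivative_of_Ck_on:
  assumes "Ck_on (Suc k) S f" "open S" "x \<in> S"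
  shows "(f has_derivative frechet_derivative f (at x)) (at x)"
  using differentiable_at_of_Ck_on[OF assms] frechet_derivative_works by blast

lemma Ck_on_const: "open S \<Longrightarrow> Ck_on k S (\<lambda>x. a)"
proof (induction k arbitrary: a)
  case (Suc k)
  show ?case by (rule Ck_on_SucI[where f' = "\<lambda>x v. 0"]) (use Suc in auto)
qed auto

lemma Ck_on_id: "open S \<Longrightarrow> Ck_on k S (\<lambda>x. x)"
proof (cases k)
  case (Suc k')
  assume "open S"
  then show ?thesis unfolding Suc
    by (intro Ck_on_SucI[where f' = "\<lambda>x v. v"]) (auto intro: Ck_on_const)
qed auto

lemma Ck_on_add: "open S \<Longrightarrow> Ck_on k S f \<Longrightarrow> Ck_on k S g \<Longrightarrow> Ck_on k S (\<lambda>x. f x + g x)"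
proof (induction k arbitrary: f g)
  case 0
  then show ?case by (simp add: continuous_on_add)
next
  case (Suc k)
  show ?case
    by (rule Ck_on_SucI[OF Suc.prems(1) has_derivative_add[OF
        has_derivative_of_Ck_on[OF Suc.prems(2,1)] has_derivative_of_Ck_on[OF Suc.prems(3,1)]]])
      (use Suc in auto)
qed

lemma Ck_on_bilinear:
  assumes "bounded_bilinear mul" "open S"
  shows "Ck_on k S f \<Longrightarrow> Ck_on k S g \<Longrightarrow> Ck_on k S (\<lambda>x. mul (f x) (g x))"
proof (induction k arbitrary: f g)
  case 0
  then show ?case using bounded_bilinear.continuous_on[OF assms(1)] by simp
next
  case (Suc k)
  show ?case
  proof (rule Ck_on_SucI[OF assms(2) bounded_bilinear.FDERIV[OF assms(1)
        has_derivative_of_Ck_on[OF Suc.prems(1) assms(2)] has_derivative_of_Ck_on[OF Suc.prems(2) assms(2)]]])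
    fix v
    show "Ck_on k S (\<lambda>x. mul (f x) (frechet_derivative g (at x) v) + mul (frechet_derivative f (at x) v) (g x))"
      by (intro Ck_on_add[OF assms(2)] Suc.IH Suc.prems[THEN Ck_on_Suc_imp] Suc.prems[THEN Ck_on_derivative])
  qed
qed

lemma Ck_on_sum:
  "open S \<Longrightarrow> (\<And>i. i \<in> I \<Longrightarrow> Ck_on k S (f i)) \<Longrightarrow> Ck_on k S (\<lambda>x. \<Sum>i\<in>I. f i x)"
  by (induction I rule: infinite_finite_induct) (auto intro: Ck_on_const Ck_on_add)

lemma Ck_on_inner: "open S \<Longrightarrow> Ck_on k S f \<Longrightarrow> Ck_on k S (\<lambda>x. f x \<bullet> a)"
  using Ck_on_bilinear[OF bounded_bilinear_inner] Ck_on_const by blast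

lemma Ck_on_inverse:
  fixes f :: "'a::real_normed_vector \<Rightarrow> real"
  assumes "open S" "\<And>x. x \<in> S \<Longrightarrow> f x \<noteq> 0"
  shows "Ck_on k S f \<Longrightarrow> Ck_on k S (\<lambda>x. inverse (f x))"
proof (induction k)
  case 0
  then show ?case using assms by (simp add: continuous_on_inverse)
next
  case (Suc k)
  show ?case
  proof (rule Ck_on_SucI[OF assms(1)])
    fix x assume x: "x \<in> S"
    show "((\<lambda>x. inverse (f x)) has_derivative
        (\<lambda>v. (- 1) * (inverse (f x) * (frechet_derivative f (at x) v * inverse (f x))))) (at x)"
      using Deriv.has_derivative_inverse[OF assms(2)[OF x] has_derivative_of_Ck_on[OF Suc.prems assms(1) x]]
      by (simp add: algebra_simps)
  next
    fix v
    show "Ck_on k S (\<lambda>x. (- 1) * (inverse (f x) * (frechet_derivative f (at x) v * inverse (f x))))"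
      by (intro Ck_on_bilinear[OF bounded_bilinear_mult assms(1)] Ck_on_const[OF assms(1)] Suc.IH
          Suc.prems[THEN Ck_on_Suc_imp] Suc.prems[THEN Ck_on_derivative])
  qed
qed

lemma frechet_derivative_eq_sum_Basis:
  fixes f :: "'a::euclidean_space \<Rightarrow> 'b::real_normed_vector"
  assumes "f differentiable (at x)"
  shows "frechet_derivative f (at x) v = (\<Sum>i\<in>Basis. (v \<bullet> i) *\<^sub>R frechet_derivative f (at x) i)"
proof -
  have "linear (frechet_derivative f (at x))"
    using assms linear_frechet_derivative by blast
  then have "frechet_derivative f (at x) (\<Sum>i\<in>Basis. (v \<bullet> i) *\<^sub>R i) =
      (\<Sum>i\<in>Basis. (v \<bullet> i) *\<^sub>R frechet_derivative f (at x) i)"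
    by (simp add: linear_sum linear_scale)
  then show ?thesis by (simp add: euclidean_representation)
qed

text \<open>
  \<open>Ck_on\<close> controls derivatives only in constant directions, whereas the chain rule produces the derivative
  of \<open>f\<close> in the moving direction \<open>Dg v\<close>. Expanding that direction in the basis reduces it to products.
\<close>

lemma Ck_on_compose:
  fixes g :: "'a::real_normed_vector \<Rightarrow> 'b::euclidean_space"
  assumes "open S" "open T" "g ` S \<subseteq> T"
  shows "Ck_on k T f \<Longrightarrow> Ck_on k S g \<Longrightarrow> Ck_on k S (\<lambda>x. f (g x))"
proof (induction k arbitrary: f)
  case 0
  then show ?case using assms continuous_on_compose2 by auto
next
  case (Suc k)
  show ?case
  proof (rule Ck_on_SucI[OF assms(1)])
    fix x assume x: "x \<in> S"
    then have gx: "g x \<in> T" using assms by auto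
    have "((\<lambda>x. f (g x)) has_derivative (\<lambda>v. frechet_derivative f (at (g x)) (frechet_derivative g (at x) v))) (at x)"
      using has_derivative_compose[OF has_derivative_of_Ck_on[OF Suc.prems(2) assms(1) x]
          has_derivative_of_Ck_on[OF Suc.prems(1) assms(2) gx]] .
    then show "((\<lambda>x. f (g x)) has_derivative (\<lambda>v. \<Sum>i\<in>Basis. (frechet_derivative g (at x) v \<bullet> i) *\<^sub>R
          frechet_derivative f (at (g x)) i)) (at x)"
      by (subst (asm) frechet_derivative_eq_sum_Basis) (use Suc.prems assms gx differentiable_at_of_Ck_on in blast)
  next
    fix v
    show "Ck_on k S (\<lambda>x. \<Sum>i\<in>Basis. (frechet_derivative g (at x) v \<bullet> i) *\<^sub>R
          frechet_derivative f (at (g x)) i)"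
      by (intro Ck_on_sum Ck_on_bilinear[OF bounded_bilinear_scaleR] Ck_on_inner assms(1) Suc.IH
          Suc.prems[THEN Ck_on_derivative] Suc.prems(2)[THEN Ck_on_Suc_imp])
  qed
qed

lemma smooth_on_eq:
  assumes "smooth_on S f" "open S" "\<And>x. x \<in> S \<Longrightarrow> f x = g x"
  shows "smooth_on S g"
  using assms Ck_on_cong[of S f g] unfolding smooth_on_def by blast

lemma smooth_on_subset: "smooth_on S f \<Longrightarrow> T \<subseteq> S \<Longrightarrow> smooth_on T f"
  unfolding smooth_on_def using Ck_on_subset by blast

lemma smooth_on_imp_continuous_on: "smooth_on S f \<Longrightarrow> continuous_on S f"
  unfolding smooth_on_def by (metis Ck_on.simps(1))

lemma smooth_on_const: "open S \<Longrightarrow> smooth_on S (\<lambda>x. a)"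
  unfolding smooth_on_def using Ck_on_const by blast

lemma smooth_on_id: "open S \<Longrightarrow> smooth_on S (\<lambda>x. x)"
  unfolding smooth_on_def using Ck_on_id by blast

lemma smooth_on_add: "open S \<Longrightarrow> smooth_on S f \<Longrightarrow> smooth_on S g \<Longrightarrow> smooth_on S (\<lambda>x. f x + g x)"
  unfolding smooth_on_def using Ck_on_add by blast

lemma smooth_on_scaleR:
  "open S \<Longrightarrow> smooth_on S h \<Longrightarrow> smooth_on S f \<Longrightarrow> smooth_on S (\<lambda>x. h x *\<^sub>R f x)"
  unfolding smooth_on_def using Ck_on_bilinear[OF bounded_bilinear_scaleR] by blast

lemma smooth_on_sum:
  "open S \<Longrightarrow> (\<And>i. i \<in> I \<Longrightarrow> smooth_on S (f i)) \<Longrightarrow> smooth_on S (\<lambda>x. \<Sum>i\<in>I. f i x)"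
  unfolding smooth_on_def by (simp add: Ck_on_sum)

lemma smooth_on_inner: "open S \<Longrightarrow> smooth_on S f \<Longrightarrow> smooth_on S (\<lambda>x. f x \<bullet> a)"
  unfolding smooth_on_def using Ck_on_inner by blast

lemma smooth_on_inverse:
  fixes f :: "'a::real_normed_vector \<Rightarrow> real"
  shows "open S \<Longrightarrow> (\<And>x. x \<in> S \<Longrightarrow> f x \<noteq> 0) \<Longrightarrow> smooth_on S f \<Longrightarrow> smooth_on S (\<lambda>x. inverse (f x))"
  unfolding smooth_on_def using Ck_on_inverse by blast

lemma smooth_on_compose:
  fixes g :: "'a::real_normed_vector \<Rightarrow> 'b::euclidean_space"
  shows "open S \<Longrightarrow> open T \<Longrightarrow> g ` S \<subseteq> T \<Longrightarrow> smooth_on T f \<Longrightarrow> smooth_on S g \<Longrightarrow> smooth_on S (\<lambda>x. f (g x))"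
  unfolding smooth_on_def using Ck_on_compose by blast

lemma smooth_on_imp_differentiable:
  "smooth_on S f \<Longrightarrow> open S \<Longrightarrow> x \<in> S \<Longrightarrow> f differentiable (at x)"
  unfolding smooth_on_def using differentiable_at_of_Ck_on by blast

lemma smooth_on_has_derivative:
  "smooth_on S f \<Longrightarrow> open S \<Longrightarrow> x \<in> S \<Longrightarrow> (f has_derivative frechet_derivative f (at x)) (at x)"
  using smooth_on_imp_differentiable frechet_derivative_works by blast

lemma smooth_on_frechet_derivative:
  fixes f :: "'a::euclidean_space \<Rightarrow> 'b::real_normed_vector"
  assumes "open S" "smooth_on S f" "smooth_on S v"
  shows "smooth_on S (\<lambda>x. frechet_derivative f (at x) (v x))"
proof -
  have "smooth_on S (\<lambda>x. frechet_derivative f (at x) i)" for i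
    using assms(2) unfolding smooth_on_def by (metis Ck_on.simps(2))
  then have "smooth_on S (\<lambda>x. \<Sum>i\<in>Basis. (v x \<bullet> i) *\<^sub>R frechet_derivative f (at x) i)"
    by (intro smooth_on_sum smooth_on_scaleR smooth_on_inner assms)
  moreover have "frechet_derivative f (at x) (v x) = (\<Sum>i\<in>Basis. (v x \<bullet> i) *\<^sub>R frechet_derivative f (at x) i)"
    if "x \<in> S" for x
    using frechet_derivative_eq_sum_Basis smooth_on_imp_differentiable[OF assms(2,1) that] by blast
  ultimately show ?thesis
    using smooth_on_eq[OF _ assms(1)] by (metis (no_types, lifting))
qed

section \<open>Charts and the chain rule\<close>

lemma chart_homeomorphism:
  assumes "smooth_atlas A" "c \<in> A"
  shows "open (fst c)" "open (snd c ` fst c)"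
    "homeomorphism (fst c) (snd c ` fst c) (snd c) (chart_inv c)"
  using assms unfolding smooth_atlas_def by auto

lemma chart_inv_chart: "smooth_atlas A \<Longrightarrow> c \<in> A \<Longrightarrow> q \<in> fst c \<Longrightarrow> chart_inv c (snd c q) = q"
  using chart_homeomorphism(3) homeomorphism_apply1 by blast

lemma open_chart_image:
  assumes "smooth_atlas A" "c \<in> A" "open U"
  shows "open (snd c ` (U \<inter> fst c))"
proof -
  note h = chart_homeomorphism[OF assms(1,2)]
  have "openin (top_of_set (fst c)) (U \<inter> fst c)"
    using openin_open_Int[OF assms(3), of "fst c"] by (simp add: Int_commute)
  then show ?thesis
    using homeomorphism_imp_open_map[OF h(3)] h(2) openin_open_eq by blast
qed

lemma chart_at_props:
  assumes "smooth_atlas A"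
  shows "chart_at A p \<in> A" "p \<in> fst (chart_at A p)"
proof -
  have "\<exists>c. c \<in> A \<and> p \<in> fst c"
    using assms unfolding smooth_atlas_def by blast
  from someI_ex[OF this] show "chart_at A p \<in> A" "p \<in> fst (chart_at A p)"
    unfolding chart_at_def by auto
qed

lemma chart_inv_UNIV [simp]: "chart_inv (UNIV, \<lambda>x. x) = (\<lambda>x. x)"
  unfolding chart_inv_def by (simp add: inv_into_def fun_eq_iff)

lemma std_chart_at [simp]: "chart_at std_atlas p = (UNIV, \<lambda>x. x)"
  unfolding chart_at_def by (rule some_equality) (auto simp: std_atlas_def)

lemma smooth_atlas_std: "smooth_atlas (std_atlas :: ('e::euclidean_space, 'e) chart set)"
  unfolding smooth_atlas_def std_atlas_def
  by (auto simp: homeomorphism_def comp_def intro: smooth_on_id)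

lemma smooth_map_on_id: "smooth_atlas A \<Longrightarrow> smooth_map_on A A UNIV (\<lambda>x. x)"
  unfolding smooth_map_on_def smooth_atlas_def by (simp add: comp_def)

lemma open_chart_domain:
  assumes "smooth_atlas A" "smooth_atlas A'" "c \<in> A" "d \<in> A'" "open U" "continuous_on U F"
  shows "open (U \<inter> fst c \<inter> F -` fst d)" "open (snd c ` (U \<inter> fst c \<inter> F -` fst d))"
proof -
  have "open (U \<inter> F -` fst d)"
    using assms(5,6) chart_homeomorphism(1)[OF assms(2,4)]
    by (simp add: continuous_open_preimage)
  then show "open (snd c ` (U \<inter> fst c \<inter> F -` fst d))" "open (U \<inter> fst c \<inter> F -` fst d)"
    using open_chart_image[OF assms(1,3)] chart_homeomorphism(1)[OF assms(1,3)]
    by (metis Int_assoc Int_commute open_Int)+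
qed

text \<open>
  The tangent space at a point is read off in the chart chosen there, so \<open>mderiv\<close>, \<open>to_chart\<close> and
  \<open>coord_field\<close> are all derivatives between coordinate representations, for different pairs of charts.
  Treating the two charts as parameters makes one chain rule serve for all of them.
\<close>

definition local_deriv ::
  "('m, 'e::real_normed_vector) chart \<Rightarrow> ('m', 'e'::real_normed_vector) chart \<Rightarrow> ('m \<Rightarrow> 'm') \<Rightarrow>
   'm \<Rightarrow> 'e \<Rightarrow> 'e'" where
  "local_deriv c d F q = frechet_derivative (\<lambda>x. snd d (F (chart_inv c x))) (at (snd c q))"

lemma to_chart_eq_local_deriv: "to_chart A c q = local_deriv (chart_at A q) c (\<lambda>x. x) q"
  unfolding to_chart_def local_deriv_def by (simp add: fun_eq_iff)

lemma coord_field_eq_local_deriv: "coord_field A c a q = local_deriv c (chart_at A q) (\<lambda>x. x) q a"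
  unfolding coord_field_def local_deriv_def by simp

lemma mderiv_eq_local_deriv:
  "mderiv A A' F q = local_deriv (chart_at A q) (chart_at A' (F q)) F q"
  unfolding mderiv_def local_deriv_def by (simp add: fun_eq_iff)

lemma local_deriv_works:
  assumes "smooth_atlas A" "smooth_atlas A'" "open U" "smooth_map_on A A' U F" "q \<in> U"
    "c \<in> A" "q \<in> fst c" "d \<in> A'" "F q \<in> fst d"
  shows "((\<lambda>x. snd d (F (chart_inv c x))) has_derivative local_deriv c d F q) (at (snd c q))"
proof -
  have "smooth_on (snd c ` (U \<inter> fst c \<inter> F -` fst d)) (\<lambda>x. snd d (F (chart_inv c x)))"
    using assms(4,6,8) unfolding smooth_map_on_def by (auto simp: comp_def)
  moreover have "open (snd c ` (U \<inter> fst c \<inter> F -` fst d))"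
    using open_chart_domain(2)[OF assms(1,2,6,8,3)] assms(4) unfolding smooth_map_on_def by blast
  ultimately show ?thesis
    unfolding local_deriv_def using assms by (intro smooth_on_has_derivative) auto
qed

lemma has_derivative_compose_in_charts:
  assumes A: "smooth_atlas A" "smooth_atlas A'" "smooth_atlas A''"
    and F: "open U" "smooth_map_on A A' U F" "q \<in> U"
    and G: "open V" "smooth_map_on A' A'' V G" "F q \<in> V"
    and c: "c \<in> A" "q \<in> fst c" and d: "d \<in> A'" "F q \<in> fst d" and e: "e \<in> A''" "G (F q) \<in> fst e"
  shows "((\<lambda>x. snd e (G (F (chart_inv c x)))) has_derivative
      (\<lambda>u. local_deriv d e G (F q) (local_deriv c d F q u))) (at (snd c q))"
proof -
  let ?S = "snd c ` (U \<inter> fst c \<inter> F -` fst d)"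
  have o: "open ?S"
    using open_chart_domain(2)[OF A(1,2) c(1) d(1) F(1)] F(2) unfolding smooth_map_on_def by blast
  have q: "snd c q \<in> ?S" using F c d by auto
  have inv: "chart_inv c (snd c q) = q" using chart_inv_chart A c by blast
  have "((\<lambda>x. snd e (G (chart_inv d (snd d (F (chart_inv c x)))))) has_derivative
      (\<lambda>u. local_deriv d e G (F q) (local_deriv c d F q u))) (at (snd c q))"
    by (rule has_derivative_compose[OF local_deriv_works[OF A(1,2) F c d]])
      (use local_deriv_works[OF A(2,3) G d e] inv in simp)
  then show ?thesis
    by (rule has_derivative_transform_within_open[OF _ o q])
      (use chart_inv_chart[OF A(1) c(1)] chart_inv_chart[OF A(2) d(1)] in auto)
qed

lemma local_deriv_compose:
  assumes "smooth_atlas A" "smooth_atlas A'" "smooth_atlas A''"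
    and "open U" "smooth_map_on A A' U F" "q \<in> U"
    and "open V" "smooth_map_on A' A'' V G" "F q \<in> V"
    and "c \<in> A" "q \<in> fst c" and "d \<in> A'" "F q \<in> fst d" and "e \<in> A''" "G (F q) \<in> fst e"
  shows "local_deriv c e (\<lambda>x. G (F x)) q u = local_deriv d e G (F q) (local_deriv c d F q u)"
  using frechet_derivative_at[OF has_derivative_compose_in_charts[OF assms]]
  unfolding local_deriv_def by metis

lemma local_deriv_id:
  assumes "smooth_atlas A" "c \<in> A" "q \<in> fst c"
  shows "local_deriv c c (\<lambda>x. x) q u = u"
proof -
  have "((\<lambda>x. snd c (chart_inv c x)) has_derivative (\<lambda>u. u)) (at (snd c q))"
    by (rule has_derivative_transform_within_open[OF has_derivative_ident
          chart_homeomorphism(2)[OF assms(1,2)]])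
      (use assms chart_inv_chart[OF assms(1,2)] in auto)
  then show ?thesis
    using frechet_derivative_at unfolding local_deriv_def by metis
qed

text \<open>
  The differential, expressed in any pair of charts, is the derivative of the coordinate representation
  of \<open>F\<close>: both sides factor the derivative from the chosen chart at \<open>q\<close> to \<open>d\<close>.
\<close>

lemma to_chart_mderiv:
  assumes "smooth_atlas A" "smooth_atlas A'" "open U" "smooth_map_on A A' U F" "q \<in> U"
    "c \<in> A" "q \<in> fst c" "d \<in> A'" "F q \<in> fst d"
  shows "to_chart A' d (F q) (mderiv A A' F q u) = local_deriv c d F q (to_chart A c q u)"
proof -
  note cA = chart_at_props[OF assms(1)] and cA' = chart_at_props[OF assms(2)]
  have "local_deriv (chart_at A q) d F q u = to_chart A' d (F q) (mderiv A A' F q u)"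
    unfolding to_chart_eq_local_deriv mderiv_eq_local_deriv
    by (rule local_deriv_compose[OF assms(1,2,2) assms(3,4,5) open_UNIV smooth_map_on_id])
      (use assms cA cA' in auto)
  moreover have "local_deriv (chart_at A q) d F q u = local_deriv c d F q (to_chart A c q u)"
    unfolding to_chart_eq_local_deriv
    by (rule local_deriv_compose[OF assms(1,1,2) open_UNIV smooth_map_on_id _ assms(3,4)])
      (use assms cA cA' in auto)
  ultimately show ?thesis by simp
qed

lemma to_chart_coord_field_change:
  assumes "smooth_atlas A" "c \<in> A" "q \<in> fst c" "d \<in> A" "q \<in> fst d"
  shows "to_chart A d q (coord_field A c a q) = local_deriv c d (\<lambda>x. x) q a"
  unfolding to_chart_eq_local_deriv coord_field_eq_local_deriv
  by (rule local_deriv_compose[OF assms(1,1,1) open_UNIV smooth_map_on_id[OF assms(1)] _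
        open_UNIV smooth_map_on_id[OF assms(1)], symmetric])
    (use assms chart_at_props[OF assms(1)] in auto)

lemma to_chart_coord_field:
  assumes "smooth_atlas A" "c \<in> A" "q \<in> fst c"
  shows "to_chart A c q (coord_field A c a q) = a"
  using to_chart_coord_field_change[OF assms assms(2,3)] local_deriv_id[OF assms] by simp

lemma coord_field_to_chart:
  assumes "smooth_atlas A" "c \<in> A" "q \<in> fst c"
  shows "coord_field A c (to_chart A c q u) q = u"
proof -
  have "local_deriv (chart_at A q) (chart_at A q) (\<lambda>x. x) q u = coord_field A c (to_chart A c q u) q"
    unfolding to_chart_eq_local_deriv coord_field_eq_local_deriv
    by (rule local_deriv_compose[OF assms(1,1,1) open_UNIV smooth_map_on_id[OF assms(1)] _
          open_UNIV smooth_map_on_id[OF assms(1)]])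
      (use assms chart_at_props[OF assms(1)] in auto)
  then show ?thesis using local_deriv_id chart_at_props assms by metis
qed

lemma linear_to_chart:
  assumes "smooth_atlas A" "c \<in> A" "q \<in> fst c"
  shows "linear (to_chart A c q)"
  unfolding to_chart_eq_local_deriv
  using local_deriv_works[OF assms(1,1) open_UNIV smooth_map_on_id[OF assms(1)]] assms
    chart_at_props[OF assms(1)] has_derivative_linear by blast

lemma linear_coord_field:
  assumes "smooth_atlas A" "c \<in> A" "q \<in> fst c"
  shows "linear (\<lambda>a. coord_field A c a q)"
  unfolding coord_field_eq_local_deriv
  using local_deriv_works[OF assms(1,1) open_UNIV smooth_map_on_id[OF assms(1)]] assms
    chart_at_props[OF assms(1)] has_derivative_linear by blast

lemma linear_mderiv:
  assumes "smooth_atlas A" "smooth_atlas A'" "open U" "smooth_map_on A A' U F" "q \<in> U"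
  shows "linear (mderiv A A' F q)"
  unfolding mderiv_eq_local_deriv
  by (rule has_derivative_linear[OF local_deriv_works[OF assms]])
    (use chart_at_props[OF assms(1)] chart_at_props[OF assms(2)] in auto)

lemma coord_field_chart_at: "smooth_atlas A \<Longrightarrow> coord_field A (chart_at A p) a p = a"
  unfolding coord_field_eq_local_deriv using local_deriv_id chart_at_props by blast

lemma mderiv_coord_field:
  assumes "smooth_atlas A" "smooth_atlas A'" "open U" "smooth_map_on A A' U F" "q \<in> U"
    "c \<in> A" "q \<in> fst c" "d \<in> A'" "F q \<in> fst d"
  shows "mderiv A A' F q (coord_field A c a q) = coord_field A' d (local_deriv c d F q a) (F q)"
  using to_chart_mderiv[OF assms, of "coord_field A c a q"] coord_field_to_chart[OF assms(2,8,9)]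
    to_chart_coord_field[OF assms(1,6,7)] by metis

section \<open>Smooth functions and vector fields\<close>

lemma smooth_fun_onI:
  assumes A: "smooth_atlas A" "open U"
    and h: "\<And>c. c \<in> A \<Longrightarrow> smooth_on (snd c ` (U \<inter> fst c)) (\<lambda>x. h (chart_inv c x))"
  shows "smooth_fun_on A U h"
proof -
  have "continuous (at q) h" if "q \<in> U" for q
  proof -
    obtain c where c: "c \<in> A" "q \<in> fst c" using A(1) unfolding smooth_atlas_def by blast
    note hc = chart_homeomorphism[OF A(1) c(1)]
    have "continuous_on (U \<inter> fst c) (\<lambda>x. h (chart_inv c (snd c x)))"
      by (rule continuous_on_compose2[OF smooth_on_imp_continuous_on[OF h[OF c(1)]]])
        (use hc(3) in \<open>auto simp: homeomorphism_def intro: continuous_on_subset[of "fst c"]\<close>)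
    then have "continuous_on (U \<inter> fst c) h"
      by (rule continuous_on_eq) (use chart_inv_chart[OF A(1) c(1)] in auto)
    then show ?thesis using c that A hc(1) continuous_on_eq_continuous_at by blast
  qed
  then have "continuous_on U h" by (simp add: continuous_at_imp_continuous_on)
  then show ?thesis using h unfolding smooth_map_on_def std_atlas_def by (auto simp: comp_def)
qed

lemma smooth_fun_onD:
  assumes "smooth_fun_on A U h" "c \<in> A"
  shows "smooth_on (snd c ` (U \<inter> fst c)) (\<lambda>x. h (chart_inv c x))"
  using assms unfolding smooth_map_on_def std_atlas_def by (auto simp: comp_def)

text \<open>Smoothness in the other charts follows because the transition maps are smooth.\<close>

lemma smooth_fun_on_single_chart:
  assumes A: "smooth_atlas A" "open U" "c \<in> A" "U \<subseteq> fst c"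
    and h: "smooth_on (snd c ` U) (\<lambda>x. h (chart_inv c x))"
  shows "smooth_fun_on A U h"
proof (rule smooth_fun_onI[OF A(1,2)])
  fix d assume d: "d \<in> A"
  have oU: "open (snd c ` U)" using open_chart_image[OF A(1,3,2)] A(4) by (simp add: Int_absorb2)
  have od: "open (snd d ` (U \<inter> fst d))" using open_chart_image[OF A(1) d A(2)] .
  have t: "smooth_on (snd d ` (U \<inter> fst d)) (\<lambda>x. snd c (chart_inv d x))"
  proof (rule smooth_on_subset)
    show "smooth_on (snd d ` (fst d \<inter> fst c)) (\<lambda>x. snd c (chart_inv d x))"
      using A(1,3) d unfolding smooth_atlas_def by (auto simp: comp_def)
  qed (use A(4) in auto)
  have "smooth_on (snd d ` (U \<inter> fst d)) (\<lambda>x. h (chart_inv c (snd c (chart_inv d x))))"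
    by (rule smooth_on_compose[OF od oU _ h t]) (use chart_inv_chart[OF A(1) d] in auto)
  then show "smooth_on (snd d ` (U \<inter> fst d)) (\<lambda>x. h (chart_inv d x))"
    by (rule smooth_on_eq[OF _ od])
      (use chart_inv_chart[OF A(1) d] chart_inv_chart[OF A(1,3)] A(4) in auto)
qed

lemma smooth_fun_on_const: "smooth_atlas A \<Longrightarrow> open U \<Longrightarrow> smooth_fun_on A U (\<lambda>q. a)"
  by (intro smooth_fun_onI smooth_on_const open_chart_image)

lemma smooth_fun_on_scale_add:
  assumes "smooth_atlas A" "open U" "smooth_fun_on A U h" "smooth_fun_on A U k" "smooth_fun_on A U l"
  shows "smooth_fun_on A U (\<lambda>q. h q + k q * l q)"
proof (rule smooth_fun_onI[OF assms(1,2)])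
  fix c assume c: "c \<in> A"
  have o: "open (snd c ` (U \<inter> fst c))" using open_chart_image assms c by blast
  show "smooth_on (snd c ` (U \<inter> fst c)) (\<lambda>x. h (chart_inv c x) + k (chart_inv c x) * l (chart_inv c x))"
    unfolding real_scaleR_def[symmetric]
    by (intro smooth_on_add[OF o] smooth_on_scaleR[OF o] assms(3-5)[THEN smooth_fun_onD[OF _ c]])
qed

lemma smooth_fun_on_divide:
  assumes "smooth_atlas A" "open U" "smooth_fun_on A U h" "smooth_fun_on A U k" "\<And>q. q \<in> U \<Longrightarrow> k q \<noteq> 0"
  shows "smooth_fun_on A U (\<lambda>q. h q / k q)"
proof (rule smooth_fun_onI[OF assms(1,2)])
  fix c assume c: "c \<in> A"
  have o: "open (snd c ` (U \<inter> fst c))" using open_chart_image assms c by blast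
  have "smooth_on (snd c ` (U \<inter> fst c)) (\<lambda>x. h (chart_inv c x) *\<^sub>R inverse (k (chart_inv c x)))"
    by (intro smooth_on_scaleR[OF o] smooth_on_inverse[OF o]
        assms(3,4)[THEN smooth_fun_onD[OF _ c]])
      (use assms(5) chart_inv_chart[OF assms(1) c] in auto)
  then show "smooth_on (snd c ` (U \<inter> fst c)) (\<lambda>x. h (chart_inv c x) / k (chart_inv c x))"
    by (simp add: divide_inverse)
qed

lemma smooth_field_on_subset:
  "smooth_field_on A U V \<Longrightarrow> U' \<subseteq> U \<Longrightarrow> smooth_field_on A U' V"
  unfolding smooth_field_on_def by (meson Int_mono image_mono order_refl smooth_on_subset)

lemma smooth_field_on_zero:
  assumes "smooth_atlas A" "open U" 
  shows "smooth_field_on A U (\<lambda>q. 0)"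
  unfolding smooth_field_on_def
proof
  fix c assume c: "c \<in> A"
  have o: "open (snd c ` (U \<inter> fst c))" using open_chart_image assms c by blast
  show "smooth_on (snd c ` (U \<inter> fst c)) (\<lambda>x. to_chart A c (chart_inv c x) 0)"
    by (rule smooth_on_eq[OF smooth_on_const[OF o, of 0] o])
      (auto simp: chart_inv_chart[OF assms(1) c] linear_0[OF linear_to_chart[OF assms(1) c]])
qed

lemma smooth_field_on_add_scaleR:
  assumes "smooth_atlas A" "open U" "smooth_field_on A U V" "smooth_field_on A U W" "smooth_fun_on A U h"
  shows "smooth_field_on A U (\<lambda>q. V q + h q *\<^sub>R W q)"
  unfolding smooth_field_on_def
proof
  fix c assume c: "c \<in> A"
  have o: "open (snd c ` (U \<inter> fst c))" using open_chart_image assms c by blast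
  have "smooth_on (snd c ` (U \<inter> fst c)) (\<lambda>x. to_chart A c (chart_inv c x) (V (chart_inv c x))
      + h (chart_inv c x) *\<^sub>R to_chart A c (chart_inv c x) (W (chart_inv c x)))"
    using assms(3,4) c smooth_fun_onD[OF assms(5) c] unfolding smooth_field_on_def
    by (intro smooth_on_add smooth_on_scaleR o) auto
  then show "smooth_on (snd c ` (U \<inter> fst c))
      (\<lambda>x. to_chart A c (chart_inv c x) (V (chart_inv c x) + h (chart_inv c x) *\<^sub>R W (chart_inv c x)))"
    by (rule smooth_on_eq[OF _ o])
      (auto simp: chart_inv_chart[OF assms(1) c] linear_add[OF linear_to_chart[OF assms(1) c]]
        linear_scale[OF linear_to_chart[OF assms(1) c]])
qed

lemma smooth_coord_field:
  assumes A: "smooth_atlas A" "c \<in> A"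
  shows "smooth_field_on A (fst c) (coord_field A c a)"
  unfolding smooth_field_on_def
proof
  fix d assume d: "d \<in> A"
  have oc: "open (snd c ` (fst d \<inter> fst c))" and od: "open (snd d ` (fst c \<inter> fst d))"
    using open_chart_image[OF A] open_chart_image[OF A(1) d] chart_homeomorphism(1)[OF A(1)] A(2) d by auto
  have tr: "smooth_on (snd b ` (fst b \<inter> fst b')) (\<lambda>x. snd b' (chart_inv b x))"
    if "b \<in> A" "b' \<in> A" for b b'
    using A(1) that unfolding smooth_atlas_def by (auto simp: comp_def)
  have "smooth_on (snd c ` (fst d \<inter> fst c))
      (\<lambda>x. frechet_derivative (\<lambda>x. snd d (chart_inv c x)) (at x) a)"
    by (rule smooth_on_frechet_derivative[OF oc _ smooth_on_const[OF oc]])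
      (use tr[OF A(2) d] in \<open>simp add: Int_commute\<close>)
  moreover have "(\<lambda>x. snd c (chart_inv d x)) ` snd d ` (fst c \<inter> fst d) \<subseteq> snd c ` (fst d \<inter> fst c)"
    by (auto simp: chart_inv_chart[OF A(1) d])
  ultimately have "smooth_on (snd d ` (fst c \<inter> fst d))
      (\<lambda>x. frechet_derivative (\<lambda>x. snd d (chart_inv c x)) (at (snd c (chart_inv d x))) a)"
    using smooth_on_compose[OF od oc] tr[OF d A(2)] by (simp add: Int_commute)
  then show "smooth_on (snd d ` (fst c \<inter> fst d))
      (\<lambda>x. to_chart A d (chart_inv d x) (coord_field A c a (chart_inv d x)))"
    by (rule smooth_on_eq[OF _ od])
      (auto simp: chart_inv_chart[OF A(1) d] to_chart_coord_field_change[OF A _ d] local_deriv_def)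
qed

lemma metric_props:
  assumes "riemannian_metric A g"
  shows "bilinear (g p)" "g p u v = g p v u" "u \<noteq> 0 \<Longrightarrow> g p u u > 0"
    "open U \<Longrightarrow> smooth_field_on A U X \<Longrightarrow> smooth_field_on A U Y \<Longrightarrow>
      smooth_fun_on A U (\<lambda>p. g p (X p) (Y p))"
  using assms unfolding riemannian_metric_def by blast+

section \<open>Horizontal vector fields\<close>

text \<open>
  Gram--Schmidt in place of an inversion of the Gram matrix: adding one field \<open>E e\<close> to the family, the induction hypothesis yields both a solution \<open>P\<close>
  for the old conditions and the orthogonal projection \<open>Q\<close> of \<open>E e\<close> to the old span. Adding a multiple of
  \<open>N = E e - Q\<close> then adjusts the new product without disturbing the old ones. Membership in the span is
  carried along since it is what makes \<open>N\<close> nonzero.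
\<close>

lemma smooth_field_with_prescribed_products:
  assumes A: "smooth_atlas A" "riemannian_metric A g" "open U"
    and "finite S"
  shows "(\<And>j. j \<in> S \<Longrightarrow> smooth_field_on A U (E j)) \<Longrightarrow> (\<And>j. j \<in> S \<Longrightarrow> smooth_fun_on A U (b j)) \<Longrightarrow>
    (\<And>q. q \<in> U \<Longrightarrow> inj_on (\<lambda>j. E j q) S \<and> independent ((\<lambda>j. E j q) ` S)) \<Longrightarrow>
    \<exists>X. smooth_field_on A U X \<and>
      (\<forall>q\<in>U. X q \<in> span ((\<lambda>j. E j q) ` S) \<and> (\<forall>j\<in>S. g q (X q) (E j q) = b j q))"
  using \<open>finite S\<close>
proof (induction S arbitrary: b rule: finite_induct)
  case empty
  then show ?case using smooth_field_on_zero[OF A(1,3)] by (intro exI[of _ "\<lambda>q. 0"]) (auto simp: span_zero)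
next
  case (insert e S)
  have indep: "inj_on (\<lambda>j. E j q) S" "independent ((\<lambda>j. E j q) ` S)" "E e q \<notin> span ((\<lambda>j. E j q) ` S)"
    if "q \<in> U" for q
  proof -
    have *: "inj_on (\<lambda>j. E j q) (insert e S)" "independent ((\<lambda>j. E j q) ` insert e S)"
      using insert.prems(3)[OF that] by auto
    then have "E e q \<notin> (\<lambda>j. E j q) ` S" using insert.hyps(2) by auto
    then show "inj_on (\<lambda>j. E j q) S" "independent ((\<lambda>j. E j q) ` S)" "E e q \<notin> span ((\<lambda>j. E j q) ` S)"
      using * by (auto simp: independent_insert)
  qed
  have sm: "\<And>j. j \<in> S \<Longrightarrow> smooth_field_on A U (E j)" "smooth_field_on A U (E e)"
      "\<And>j. j \<in> S \<Longrightarrow> smooth_fun_on A U (b j)" "smooth_fun_on A U (b e)"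
    using insert.prems by auto
  obtain P where P: "smooth_field_on A U P" "\<And>q. q \<in> U \<Longrightarrow> P q \<in> span ((\<lambda>j. E j q) ` S)"
      "\<And>q j. q \<in> U \<Longrightarrow> j \<in> S \<Longrightarrow> g q (P q) (E j q) = b j q"
    using insert.IH[of b] sm indep by blast
  obtain Q where Q: "smooth_field_on A U Q" "\<And>q. q \<in> U \<Longrightarrow> Q q \<in> span ((\<lambda>j. E j q) ` S)"
      "\<And>q j. q \<in> U \<Longrightarrow> j \<in> S \<Longrightarrow> g q (Q q) (E j q) = g q (E e q) (E j q)"
    using insert.IH[of "\<lambda>j q. g q (E e q) (E j q)"] sm indep metric_props(4)[OF A(2,3)] by blast
  \<comment> \<open>\<open>N\<close> is the component of \<open>E e\<close> orthogonal to the span of the other fields.\<close>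
  define N where "N = (\<lambda>q. E e q + (-1) *\<^sub>R Q q)"
  have N: "smooth_field_on A U N"
    unfolding N_def by (intro smooth_field_on_add_scaleR A(1,3) sm Q smooth_fun_on_const)
  have lin: "linear (\<lambda>u. g q u v)" "linear (g q v)" for q v
    using metric_props(1)[OF A(2)] unfolding bilinear_def by auto
  have orth: "g q (N q) (E j q) = 0" if "q \<in> U" "j \<in> S" for q j
    using Q(3)[OF that] unfolding N_def by (simp add: linear_diff[OF lin(1)])
  have "g q (N q) (E e q) \<noteq> 0" if q: "q \<in> U" for q
  proof -
    have "N q \<noteq> 0" using indep(3)[OF q] Q(2)[OF q] unfolding N_def by auto
    then have "g q (N q) (N q) > 0" using metric_props(3)[OF A(2)] by blast
    moreover have "g q (N q) w = 0" if "w \<in> span ((\<lambda>j. E j q) ` S)" for w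
      using that
    proof (induction w rule: span_induct)
      case base
      then show ?case using lin(2) by (simp add: linear_subspace_kernel)
    next
      case (step w)
      then show ?case using orth[OF q] by auto
    qed
    then have "g q (N q) (Q q) = 0" using Q(2)[OF q] by blast
    then have "g q (N q) (N q) = g q (N q) (E e q)"
      unfolding N_def by (simp add: linear_diff[OF lin(2)])
    ultimately show ?thesis by simp
  qed
  note ne = this
  define h where "h = (\<lambda>q. (b e q + (-1) * g q (P q) (E e q)) / g q (N q) (E e q))"
  have h: "smooth_fun_on A U h"
    unfolding h_def
    by (intro smooth_fun_on_divide smooth_fun_on_scale_add smooth_fun_on_const A(1,3) sm
        metric_props(4)[OF A(2,3)] P(1) N ne)
  show ?case
  proof (intro exI[of _ "\<lambda>q. P q + h q *\<^sub>R N q"] conjI ballI)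
    show "smooth_field_on A U (\<lambda>q. P q + h q *\<^sub>R N q)"
      by (intro smooth_field_on_add_scaleR A(1,3) P(1) N h)
    fix q assume q: "q \<in> U"
    have "span ((\<lambda>j. E j q) ` S) \<subseteq> span ((\<lambda>j. E j q) ` insert e S)"
      by (intro span_mono) auto
    then have "P q \<in> span ((\<lambda>j. E j q) ` insert e S)" "Q q \<in> span ((\<lambda>j. E j q) ` insert e S)"
      using P(2)[OF q] Q(2)[OF q] by auto
    then show "P q + h q *\<^sub>R N q \<in> span ((\<lambda>j. E j q) ` insert e S)"
      unfolding N_def by (intro span_add span_scale) (auto intro: span_base)
    fix j assume "j \<in> insert e S"
    then show "g q (P q + h q *\<^sub>R N q) (E j q) = b j q"
      using P(3)[OF q] orth[OF q] ne[OF q]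
      by (auto simp: h_def linear_add[OF lin(1)] linear_scale[OF lin(1)])
  qed
qed

text \<open>
  If \<open>W\<close> is a field on the target, the vectors \<open>X\<close> with \<open>g X v = g' (F\<^sub>* v) W\<close> for all \<open>v\<close> are horizontal,
  since the right-hand side vanishes on \<open>ker F\<^sub>*\<close>. They form a smooth field by the preceding lemma, applied
  to a coordinate frame. Choosing \<open>W = F\<^sub>* u\<close> at \<open>F p\<close> gives \<open>X p = u\<close>, because \<open>F\<^sub>*\<close> is isometric on horizontal
  vectors.
\<close>

lemma horizontal_extension:
  fixes F :: "'n::{t2_space,second_countable_topology} \<Rightarrow> 'b::{t2_space,second_countable_topology}"
    and A :: "('n, 'e::euclidean_space) chart set" and A' :: "('b, 'h::euclidean_space) chart set"
  assumes A: "smooth_atlas A" "smooth_atlas A'" and g: "riemannian_metric A g" "riemannian_metric A' g'"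
    and F: "riemannian_map A g A' g' F" and u: "u \<in> horizontal A A' g F p"
  obtains U X where "open U" "p \<in> U" "smooth_field_on A U X"
    "\<And>q. q \<in> U \<Longrightarrow> X q \<in> horizontal A A' g F q" "X p = u"
proof -
  have Fs: "smooth_map_on A A' UNIV F" using F unfolding riemannian_map_def by blast
  define c where "c = chart_at A p"
  define d where "d = chart_at A' (F p)"
  have c: "c \<in> A" "p \<in> fst c" and d: "d \<in> A'" "F p \<in> fst d"
    using chart_at_props[OF A(1)] chart_at_props[OF A(2)] unfolding c_def d_def by auto
  define U where "U = fst c \<inter> F -` fst d"
  have contF: "continuous_on UNIV F" using Fs unfolding smooth_map_on_def by blast
  have U: "open U" "open (snd c ` U)"
    using open_chart_domain[OF A c(1) d(1) open_UNIV contF] unfolding U_def by auto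
  define E where "E = coord_field A c"
  define W where "W = coord_field A' d (mderiv A A' F p u)"
  define b where "b = (\<lambda>a q. g' (F q) (mderiv A A' F q (E a q)) (W (F q)))"
  let ?F = "\<lambda>x. snd d (F (chart_inv c x))"
  have sF: "smooth_on (snd c ` U) ?F"
    using Fs c(1) d(1) unfolding smooth_map_on_def U_def by (auto simp: comp_def)
  have lin': "linear (\<lambda>u. g' q u v)" "linear (g' q v)" for q v
    using metric_props(1)[OF g(2)] unfolding bilinear_def by auto
  have lin: "linear (\<lambda>u. g q u v)" "linear (g q v)" for q v
    using metric_props(1)[OF g(1)] unfolding bilinear_def by auto
  have linF: "linear (mderiv A A' F q)" for q
    using linear_mderiv[OF A open_UNIV Fs UNIV_I] .
  have linE: "linear (\<lambda>a. E a q)" if "q \<in> fst c" for q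
    using linear_coord_field[OF A(1) c(1) that] unfolding E_def .
  have b: "smooth_fun_on A U (b a)" for a
  proof (rule smooth_fun_on_single_chart[OF A(1) U(1) c(1)])
    let ?G = "\<lambda>i y. g' y (coord_field A' d i y) (W y)"
    have G: "smooth_fun_on A' (fst d) (?G i)" for i
      unfolding W_def
      by (intro metric_props(4)[OF g(2)] chart_homeomorphism(1)[OF A(2) d(1)] smooth_coord_field[OF A(2) d(1)])
    have "smooth_on (snd c ` U) (\<lambda>x. ?G i (chart_inv d (?F x)))" for i
    proof (rule smooth_on_compose[OF U(2) _ _ _ sF])
      show "open (snd d ` fst d)" using chart_homeomorphism(2)[OF A(2) d(1)] .
      show "?F ` snd c ` U \<subseteq> snd d ` fst d" unfolding U_def by (auto simp: chart_inv_chart[OF A(1) c(1)])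
      show "smooth_on (snd d ` fst d) (\<lambda>x. ?G i (chart_inv d x))"
        using smooth_fun_onD[OF G d(1)] by simp
    qed
    then have "smooth_on (snd c ` U) (\<lambda>x. \<Sum>i\<in>Basis. (frechet_derivative ?F (at x) a \<bullet> i) *\<^sub>R ?G i (chart_inv d (?F x)))"
      by (intro smooth_on_sum[OF U(2)] smooth_on_scaleR[OF U(2)] smooth_on_inner[OF U(2)]
          smooth_on_frechet_derivative[OF U(2) sF smooth_on_const[OF U(2)]])
    then show "smooth_on (snd c ` U) (\<lambda>x. b a (chart_inv c x))"
    proof (rule smooth_on_eq[OF _ U(2)])
      fix x assume "x \<in> snd c ` U"
      then obtain q where q: "q \<in> U" "x = snd c q" by auto
      then have qc: "q \<in> fst c" "F q \<in> fst d" unfolding U_def by auto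
      have linE': "linear (\<lambda>a. coord_field A' d a (F q))"
        using linear_coord_field[OF A(2) d(1) qc(2)] .
      have "b a q = g' (F q) (coord_field A' d (local_deriv c d F q a) (F q)) (W (F q))"
        unfolding b_def E_def using mderiv_coord_field[OF A open_UNIV Fs _ c(1) qc(1) d(1) qc(2)] by simp
      also have "local_deriv c d F q a = (\<Sum>i\<in>Basis. (local_deriv c d F q a \<bullet> i) *\<^sub>R i)"
        by (simp add: euclidean_representation)
      also have "g' (F q) (coord_field A' d \<dots> (F q)) (W (F q)) =
          (\<Sum>i\<in>Basis. (local_deriv c d F q a \<bullet> i) *\<^sub>R ?G i (F q))"
        by (simp add: linear_sum[OF linE'] linear_scale[OF linE'] linear_sum[OF lin'(1)] linear_scale[OF lin'(1)])
      finally show "(\<Sum>i\<in>Basis. (frechet_derivative ?F (at x) a \<bullet> i) *\<^sub>R ?G i (chart_inv d (?F x))) = b a (chart_inv c x)"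
        by (simp add: q(2) chart_inv_chart[OF A(1) c(1) qc(1)] chart_inv_chart[OF A(2) d(1) qc(2)] local_deriv_def)
    qed
  qed (auto simp: U_def)
  have sE: "smooth_field_on A U (E a)" for a
    using smooth_field_on_subset[OF smooth_coord_field[OF A(1) c(1)]] unfolding E_def U_def by auto
  have indep: "inj_on (\<lambda>a. E a q) Basis \<and> independent ((\<lambda>a. E a q) ` Basis)" if "q \<in> U" for q
  proof -
    have q: "q \<in> fst c" using that unfolding U_def by auto
    have inj: "inj (\<lambda>a. E a q)"
      unfolding E_def using to_chart_coord_field[OF A(1) c(1) q] by (metis injI)
    then show ?thesis
      using linear_independent_injective_image[OF linE[OF q] independent_Basis] inj_on_subset by auto
  qed
  obtain X where X: "smooth_field_on A U X" "\<And>q a. q \<in> U \<Longrightarrow> a \<in> Basis \<Longrightarrow> g q (X q) (E a q) = b a q"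
    using smooth_field_with_prescribed_products[OF A(1) g(1) U(1) finite_Basis, of E b] sE b indep by blast
  have adjoint: "g q (X q) v = g' (F q) (mderiv A A' F q v) (W (F q))" if q: "q \<in> U" for q v
  proof -
    have qc: "q \<in> fst c" using q unfolding U_def by auto
    have "(\<lambda>a. g q (X q) (E a q)) = (\<lambda>a. b a q)"
    proof (rule linear_eq_stdbasis)
      show "linear (\<lambda>a. g q (X q) (E a q))"
        using linear_compose[OF linE[OF qc] lin(2)] by (simp add: comp_def)
      show "linear (\<lambda>a. b a q)"
        using linear_compose[OF linear_compose[OF linE[OF qc] linF] lin'(1)] by (simp add: comp_def b_def)
    qed (use X(2)[OF q] in auto)
    from fun_cong[OF this, of "to_chart A c q v"] show ?thesis
      unfolding b_def E_def coord_field_to_chart[OF A(1) c(1) qc] .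
  qed
  have pU: "p \<in> U" using c d unfolding U_def by auto
  have "X q \<in> horizontal A A' g F q" if "q \<in> U" for q
    using adjoint[OF that] linear_0[OF lin'(1)] unfolding horizontal_def orth_def by auto
  moreover have "X p = u"
  proof (rule ccontr)
    assume "X p \<noteq> u"
    have "g p (X p) v = g p u v" for v
    proof -
      \<comment> \<open>Split \<open>v\<close> into a horizontal and a vertical vector; \<open>F\<^sub>*\<close> and \<open>g p u\<close> only see the horizontal one.\<close>
      have "mderiv A A' F p v \<in> mderiv A A' F p ` horizontal A A' g F p"
        using F unfolding riemannian_map_def by blast
      then obtain h where h: "h \<in> horizontal A A' g F p" "mderiv A A' F p v = mderiv A A' F p h" by blast
      have "mderiv A A' F p (v - h) = 0" using h(2) linear_diff[OF linF] by simp
      then have "g p u (v - h) = 0" using u unfolding horizontal_def orth_def by blast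
      then have "g p u v = g p u h" using linear_diff[OF lin(2)] by simp
      also have "\<dots> = g' (F p) (mderiv A A' F p u) (mderiv A A' F p h)"
        using F u h(1) unfolding riemannian_map_def by simp
      also have "\<dots> = g p (X p) v"
        using adjoint[OF pU] h(2) metric_props(2)[OF g(2)] coord_field_chart_at[OF A(2)]
        unfolding W_def d_def by simp
      finally show ?thesis by simp
    qed
    then have "g p (X p - u) (X p - u) = 0" using linear_diff[OF lin(1)] by simp
    then show False using metric_props(3)[OF g(1), of "X p - u" p] \<open>X p \<noteq> u\<close> by simp
  qed
  ultimately show ?thesis using that U(1) pU X(1) by blast
qed

section \<open>Derivative of the fundamental form\<close>

lemma bilinear_eq_sum_Basis:
  fixes D :: "'h::euclidean_space \<Rightarrow> 'h \<Rightarrow> real"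
  assumes "bilinear D"
  shows "D a b = (\<Sum>i\<in>Basis. \<Sum>j\<in>Basis. (a \<bullet> i) * (b \<bullet> j) * D i j)"
proof -
  have "D a b = D (\<Sum>i\<in>Basis. (a \<bullet> i) *\<^sub>R i) (\<Sum>j\<in>Basis. (b \<bullet> j) *\<^sub>R j)"
    by (simp add: euclidean_representation)
  also have "\<dots> = (\<Sum>(i,j)\<in>Basis \<times> Basis. D ((a \<bullet> i) *\<^sub>R i) ((b \<bullet> j) *\<^sub>R j))"
    by (rule bilinear_sum[OF assms])
  also have "\<dots> = (\<Sum>i\<in>Basis. \<Sum>j\<in>Basis. (a \<bullet> i) * (b \<bullet> j) * D i j)"
    by (simp add: sum.cartesian_product bilinear_lmul[OF assms] bilinear_rmul[OF assms] ac_simps)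
  finally show ?thesis .
qed

text \<open>
  The product rule for a bilinear form varying with the point, where the form is only required to be
  differentiable on constant arguments; these will be coordinate frames.
\<close>

lemma has_derivative_bilinear_form:
  fixes B :: "'x::real_normed_vector \<Rightarrow> 'h::euclidean_space \<Rightarrow> 'h \<Rightarrow> real"
  assumes S: "open S" "x \<in> S" and B: "\<And>y. y \<in> S \<Longrightarrow> bilinear (B y)"
    and dB: "\<And>i j. ((\<lambda>y. B y i j) has_derivative (\<lambda>u. C u i j)) (at x)"
    and C: "\<And>u. bilinear (C u)"
    and v: "(v has_derivative v') (at x)" and w: "(w has_derivative w') (at x)"
  shows "((\<lambda>y. B y (v y) (w y)) has_derivative
    (\<lambda>u. B x (v' u) (w x) + B x (v x) (w' u) + C u (v x) (w x))) (at x)"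
proof -
  have "((\<lambda>y. \<Sum>i\<in>Basis. \<Sum>j\<in>Basis. (v y \<bullet> i) * (w y \<bullet> j) * B y i j) has_derivative
    (\<lambda>u. \<Sum>i\<in>Basis. \<Sum>j\<in>Basis. (v x \<bullet> i) * (w x \<bullet> j) * C u i j +
        ((v x \<bullet> i) * (w' u \<bullet> j) + (v' u \<bullet> i) * (w x \<bullet> j)) * B x i j)) (at x)"
    by (intro has_derivative_sum has_derivative_mult has_derivative_inner_left v w dB)
  then have "((\<lambda>y. \<Sum>i\<in>Basis. \<Sum>j\<in>Basis. (v y \<bullet> i) * (w y \<bullet> j) * B y i j) has_derivative
    (\<lambda>u. B x (v' u) (w x) + B x (v x) (w' u) + C u (v x) (w x))) (at x)"
    unfolding bilinear_eq_sum_Basis[OF B[OF S(2)], of "v' _"] bilinear_eq_sum_Basis[OF B[OF S(2)], of "v x"]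
      bilinear_eq_sum_Basis[OF C, of _ "v x"]
    by (simp add: sum.distrib[symmetric] algebra_simps)
  then show ?thesis
    by (rule has_derivative_transform_within_open[OF _ S]) (simp add: bilinear_eq_sum_Basis[OF B])
qed

lemma connection_props:
  assumes "affine_connection A nabla" "open U" "p \<in> U"
  shows "smooth_field_on A U V \<Longrightarrow> linear (\<lambda>u. nabla p u V)"
    "smooth_field_on A U V \<Longrightarrow> smooth_field_on A U W \<Longrightarrow>
      nabla p u (\<lambda>q. V q + W q) = nabla p u V + nabla p u W"
    "smooth_fun_on A U h \<Longrightarrow> smooth_field_on A U V \<Longrightarrow>
      nabla p u (\<lambda>q. h q *\<^sub>R V q) = dfun A h p u *\<^sub>R V p + h p *\<^sub>R nabla p u V"
    "smooth_field_on A U V \<Longrightarrow> smooth_field_on A U W \<Longrightarrow> (\<And>q. q \<in> U \<Longrightarrow> V q = W q) \<Longrightarrow>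
      nabla p u V = nabla p u W"
proof -
  note conn = assms(1)[unfolded affine_connection_def]
  show "linear (\<lambda>u. nabla p u V)" if "smooth_field_on A U V"
    using conn[THEN conjunct1] assms(2,3) that by simp
  show "nabla p u (\<lambda>q. V q + W q) = nabla p u V + nabla p u W"
    if "smooth_field_on A U V" "smooth_field_on A U W"
    using conn[THEN conjunct2, THEN conjunct1] assms(2,3) that by simp
  show "nabla p u (\<lambda>q. h q *\<^sub>R V q) = dfun A h p u *\<^sub>R V p + h p *\<^sub>R nabla p u V"
    if "smooth_fun_on A U h" "smooth_field_on A U V"
    using conn[THEN conjunct2, THEN conjunct2, THEN conjunct1] assms(2,3) that by simp
  show "nabla p u V = nabla p u W"
    if "smooth_field_on A U V" "smooth_field_on A U W" "\<And>q. q \<in> U \<Longrightarrow> V q = W q"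
    using conn[THEN conjunct2, THEN conjunct2, THEN conjunct2, THEN conjunct1] assms(2,3) that by blast
qed

lemma dfun_const: "dfun A (\<lambda>q. r) p u = 0"
  unfolding mderiv_def by (simp add: frechet_derivative_const)

text \<open>
  \<open>pullback_cov\<close> differentiates the coordinate field with the components of the given vector; linearity in
  these components is what matches it with the product rule above.
\<close>

lemma linear_nabla_coord_field:
  assumes A: "smooth_atlas A" "affine_connection A nabla" "d \<in> A" "y \<in> fst d"
  shows "linear (\<lambda>a. nabla y z (coord_field A d a))"
proof -
  note o = chart_homeomorphism(1)[OF A(1,3)]
  note conn = connection_props[OF A(2) o A(4)]
  note E = smooth_coord_field[OF A(1,3)] and linE = linear_coord_field[OF A(1,3)]
  show ?thesis
  proof (rule linearI)
    fix a b
    have "smooth_field_on A (fst d) (\<lambda>q. coord_field A d a q + 1 *\<^sub>R coord_field A d b q)"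
      by (intro smooth_field_on_add_scaleR[OF A(1) o E E] smooth_fun_on_const A(1) o)
    then have "nabla y z (coord_field A d (a + b)) = nabla y z (\<lambda>q. coord_field A d a q + coord_field A d b q)"
      by (intro conn(4) E) (auto simp: linear_add[OF linE])
    then show "nabla y z (coord_field A d (a + b)) = nabla y z (coord_field A d a) + nabla y z (coord_field A d b)"
      using conn(2)[OF E E] by simp
  next
    fix r a
    have "smooth_field_on A (fst d) (\<lambda>q. 0 + r *\<^sub>R coord_field A d a q)"
      by (intro smooth_field_on_add_scaleR[OF A(1) o _ E] smooth_field_on_zero smooth_fun_on_const A(1) o)
    then have "nabla y z (coord_field A d (r *\<^sub>R a)) = nabla y z (\<lambda>q. r *\<^sub>R coord_field A d a q)"
      by (intro conn(4) E) (auto simp: linear_scale[OF linE])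
    also have "\<dots> = r *\<^sub>R nabla y z (coord_field A d a)"
      using conn(3)[OF smooth_fun_on_const[OF A(1) o] E] by (simp add: dfun_const)
    finally show "nabla y z (coord_field A d (r *\<^sub>R a)) = r *\<^sub>R nabla y z (coord_field A d a)" .
  qed
qed

lemma sasakian_props:
  assumes "sasakian_manifold A \<phi> \<xi> \<eta> g nabla"
  shows "smooth_atlas A" "riemannian_metric A g" "levi_civita A g nabla" "affine_connection A nabla"
    "linear (\<phi> p)" "linear (\<eta> p)"
    "open U \<Longrightarrow> smooth_field_on A U V \<Longrightarrow> smooth_field_on A U (\<lambda>p. \<phi> p (V p))"
    "\<eta> p u = g p u (\<xi> p)"
    "open U \<Longrightarrow> p \<in> U \<Longrightarrow> smooth_field_on A U V \<Longrightarrow>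
      nabla p u (\<lambda>q. \<phi> q (V q)) = \<phi> p (nabla p u V) + g p u (V p) *\<^sub>R \<xi> p - \<eta> p (V p) *\<^sub>R u"
proof -
  note S = assms[unfolded sasakian_manifold_def riemannian_manifold_def]
  show A: "smooth_atlas A" "riemannian_metric A g" "levi_civita A g nabla"
    using S by - (elim conjE, assumption)+
  show "affine_connection A nabla" using A(3) unfolding levi_civita_def by (elim conjE)
  have "\<forall>p. linear (\<phi> p)" "\<forall>p. linear (\<eta> p)" "\<forall>p u. \<eta> p u = g p u (\<xi> p)"
    using S by - (elim conjE, assumption)+
  then show "linear (\<phi> p)" "linear (\<eta> p)" "\<eta> p u = g p u (\<xi> p)" by blast+
  have "\<forall>U V. open U \<and> smooth_field_on A U V \<longrightarrow> smooth_field_on A U (\<lambda>p. \<phi> p (V p))"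
    using S by (elim conjE)
  then show "smooth_field_on A U (\<lambda>p. \<phi> p (V p))" if "open U" "smooth_field_on A U V"
    using that by simp
  have "\<forall>U V p u. open U \<and> p \<in> U \<and> smooth_field_on A U V \<longrightarrow>
      nabla p u (\<lambda>q. \<phi> q (V q)) - \<phi> p (nabla p u V) = g p u (V p) *\<^sub>R \<xi> p - \<eta> p (V p) *\<^sub>R u"
    using S by (elim conjE)
  then have "nabla p u (\<lambda>q. \<phi> q (V q)) - \<phi> p (nabla p u V) = g p u (V p) *\<^sub>R \<xi> p - \<eta> p (V p) *\<^sub>R u"
    if "open U" "p \<in> U" "smooth_field_on A U V"
    using that by simp
  then show "nabla p u (\<lambda>q. \<phi> q (V q)) = \<phi> p (nabla p u V) + g p u (V p) *\<^sub>R \<xi> p - \<eta> p (V p) *\<^sub>R u"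
    if "open U" "p \<in> U" "smooth_field_on A U V"
    using that by (simp add: diff_eq_eq add.commute add_diff_eq)
qed

text \<open>Metric compatibility combined with the Sasakian formula for the derivative of \<open>\<phi>\<close>.\<close>

lemma dfun_fundamental_form:
  assumes S: "sasakian_manifold A \<phi> \<xi> \<eta> g nabla" and U: "open U" "p \<in> U"
    and V: "smooth_field_on A U V" and W: "smooth_field_on A U W"
  shows "smooth_fun_on A U (\<lambda>q. g q (\<phi> q (V q)) (W q))"
    "dfun A (\<lambda>q. g q (\<phi> q (V q)) (W q)) p u =
      g p (\<phi> p (nabla p u V) + g p u (V p) *\<^sub>R \<xi> p - \<eta> p (V p) *\<^sub>R u) (W p) + g p (\<phi> p (V p)) (nabla p u W)"
proof -
  have \<phi>V: "smooth_field_on A U (\<lambda>q. \<phi> q (V q))" using sasakian_props(7)[OF S U(1) V] .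
  show "smooth_fun_on A U (\<lambda>q. g q (\<phi> q (V q)) (W q))"
    using metric_props(4)[OF sasakian_props(2)[OF S] U(1) \<phi>V W] .
  have "dfun A (\<lambda>q. g q (\<phi> q (V q)) (W q)) p u =
      g p (nabla p u (\<lambda>q. \<phi> q (V q))) (W p) + g p (\<phi> p (V p)) (nabla p u W)"
    using sasakian_props(3)[OF S] U \<phi>V W unfolding levi_civita_def by blast
  then show "dfun A (\<lambda>q. g q (\<phi> q (V q)) (W q)) p u =
      g p (\<phi> p (nabla p u V) + g p u (V p) *\<^sub>R \<xi> p - \<eta> p (V p) *\<^sub>R u) (W p) + g p (\<phi> p (V p)) (nabla p u W)"
    using sasakian_props(9)[OF S U V] by simp
qed

text \<open>
  The same formula for fields \<open>V\<close>, \<open>W\<close> along \<open>F\<close>, which need not extend to the target. Their components in the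
  chart at \<open>F p\<close> are functions on the source; the product rule separates the derivatives of these components
  from those of \<open>\<Omega>\<close> on the coordinate frame, for which the preceding lemma is available. The two kinds of
  terms add up to the two summands of the pullback connection.
\<close>

lemma fundamental_form_has_derivative_along:
  fixes F :: "'n::{t2_space,second_countable_topology} \<Rightarrow> 'b::{t2_space,second_countable_topology}"
    and A :: "('n, 'e::euclidean_space) chart set" and A' :: "('b, 'h::euclidean_space) chart set"
    and p :: 'n and V W :: "'n \<Rightarrow> 'h"
  defines "c \<equiv> chart_at A p" and "d \<equiv> chart_at A' (F p)"
  assumes A: "smooth_atlas A" and S: "sasakian_manifold A' \<phi> \<xi> \<eta> g nabla"
    and F: "smooth_map_on A A' UNIV F"
    and V: "(\<lambda>x. to_chart A' d (F (chart_inv c x)) (V (chart_inv c x))) differentiable (at (snd c p))"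
    and W: "(\<lambda>x. to_chart A' d (F (chart_inv c x)) (W (chart_inv c x))) differentiable (at (snd c p))"
  shows "((\<lambda>x. g (F (chart_inv c x)) (\<phi> (F (chart_inv c x)) (V (chart_inv c x))) (W (chart_inv c x)))
    has_derivative (\<lambda>u.
      g (F p) (\<phi> (F p) (pullback_cov A A' nabla F p u V)
          + g (F p) (mderiv A A' F p u) (V p) *\<^sub>R \<xi> (F p) - \<eta> (F p) (V p) *\<^sub>R mderiv A A' F p u) (W p)
      + g (F p) (\<phi> (F p) (V p)) (pullback_cov A A' nabla F p u W))) (at (snd c p))"
proof -
  note A' = sasakian_props(1)[OF S]
  have c: "c \<in> A" "p \<in> fst c" and d: "d \<in> A'" "F p \<in> fst d"
    using chart_at_props[OF A] chart_at_props[OF A'] unfolding c_def d_def by auto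
  have contF: "continuous_on UNIV F" using F unfolding smooth_map_on_def by blast
  note od = chart_homeomorphism(1)[OF A' d(1)] and E = smooth_coord_field[OF A' d(1)]
  define T where "T = snd c ` (fst c \<inter> F -` fst d)"
  have T: "open T" "snd c p \<in> T"
    using open_chart_domain(2)[OF A A' c(1) d(1) open_UNIV contF] c d unfolding T_def by auto
  have Tc: "chart_inv c x \<in> fst c" "F (chart_inv c x) \<in> fst d" if "x \<in> T" for x
    using that chart_inv_chart[OF A c(1)] unfolding T_def by auto
  have pc: "chart_inv c (snd c p) = p" using chart_inv_chart[OF A c] .
  have Ep: "coord_field A' d a (F p) = a" for a
    using coord_field_chart_at[OF A'] unfolding d_def .
  have ling: "linear (\<lambda>u. g q u v)" "linear (g q v)" for q v
    using metric_props(1)[OF sasakian_props(2)[OF S]] unfolding bilinear_def by auto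
  note lin = ling sasakian_props(5)[OF S] sasakian_props(6)[OF S]
  have linE: "linear (\<lambda>a. coord_field A' d a y)" if "y \<in> fst d" for y
    using linear_coord_field[OF A' d(1) that] .
  have linN: "linear (\<lambda>a. nabla (F p) z (coord_field A' d a))" for z
    using linear_nabla_coord_field[OF A' sasakian_props(4)[OF S] d] .
  \<comment> \<open>\<open>B\<close> is the matrix of \<open>\<Omega>\<close> in the coordinate frame, pulled back to the source; \<open>C\<close> is its derivative.\<close>
  define B where "B = (\<lambda>x a b. let y = F (chart_inv c x) in
      g y (\<phi> y (coord_field A' d a y)) (coord_field A' d b y))"
  define C where "C = (\<lambda>u a b. let z = mderiv A A' F p u in
      g (F p) (\<phi> (F p) (nabla (F p) z (coord_field A' d a)) + g (F p) z a *\<^sub>R \<xi> (F p) - \<eta> (F p) a *\<^sub>R z) b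
      + g (F p) (\<phi> (F p) a) (nabla (F p) z (coord_field A' d b)))"
  let ?v = "\<lambda>V x. to_chart A' d (F (chart_inv c x)) (V (chart_inv c x))"
  let ?dv = "\<lambda>V. frechet_derivative (?v V) (at (snd c p))"
  have main: "((\<lambda>x. B x (?v V x) (?v W x)) has_derivative
    (\<lambda>u. B (snd c p) (?dv V u) (?v W (snd c p)) + B (snd c p) (?v V (snd c p)) (?dv W u)
       + C u (?v V (snd c p)) (?v W (snd c p)))) (at (snd c p))"
  proof (rule has_derivative_bilinear_form[OF T])
    fix x assume x: "x \<in> T"
    show "bilinear (B x)"
      unfolding bilinear_def linear_iff B_def Let_def
      by (simp add: linear_add[OF linE[OF Tc(2)[OF x]]] linear_scale[OF linE[OF Tc(2)[OF x]]]
          linear_add[OF lin(1)] linear_add[OF lin(2)] linear_add[OF lin(3)]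
          linear_scale[OF lin(1)] linear_scale[OF lin(2)] linear_scale[OF lin(3)])
  next
    fix u
    show "bilinear (C u)"
      unfolding bilinear_def linear_iff C_def Let_def
      by (simp add: linear_add[OF linN] linear_scale[OF linN] linear_diff[OF lin(1)]
          linear_add[OF lin(1)] linear_add[OF lin(2)] linear_add[OF lin(3)] linear_add[OF lin(4)]
          linear_scale[OF lin(1)] linear_scale[OF lin(2)] linear_scale[OF lin(3)] linear_scale[OF lin(4)]
          algebra_simps)
  next
    fix i j
    let ?h = "\<lambda>y. g y (\<phi> y (coord_field A' d i y)) (coord_field A' d j y)"
    let ?e = "(UNIV, \<lambda>x. x) :: (real, real) chart"
    have h: "smooth_fun_on A' (fst d) ?h" using dfun_fundamental_form(1)[OF S od d(2) E E] .
    have "((\<lambda>x. snd ?e (?h (F (chart_inv c x)))) has_derivative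
        (\<lambda>u. local_deriv d ?e ?h (F p) (local_deriv c d F p u))) (at (snd c p))"
      by (rule has_derivative_compose_in_charts[OF A A' smooth_atlas_std open_UNIV F UNIV_I od h d(2) c d])
        (auto simp: std_atlas_def)
    moreover have "local_deriv d ?e ?h (F p) (local_deriv c d F p u) = C u i j" for u
    proof -
      have "local_deriv d ?e ?h (F p) (local_deriv c d F p u)
          = dfun A' ?h (F p) (mderiv A A' F p u)"
        unfolding mderiv_eq_local_deriv c_def d_def by simp
      then show ?thesis
        using dfun_fundamental_form(2)[OF S od d(2) E E] by (simp add: C_def Let_def Ep)
    qed
    ultimately show "((\<lambda>x. B x i j) has_derivative (\<lambda>u. C u i j)) (at (snd c p))"
      by (simp add: B_def Let_def)
  qed (use V W frechet_derivative_works in blast)+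
  have vp: "?v V (snd c p) = V p" for V
    using coord_field_to_chart[OF A' d, of "V p"] Ep pc by simp
  have "((\<lambda>x. g (F (chart_inv c x)) (\<phi> (F (chart_inv c x)) (V (chart_inv c x))) (W (chart_inv c x)))
    has_derivative (\<lambda>u. B (snd c p) (?dv V u) (?v W (snd c p)) + B (snd c p) (?v V (snd c p)) (?dv W u)
       + C u (?v V (snd c p)) (?v W (snd c p)))) (at (snd c p))"
    by (rule has_derivative_transform_within_open[OF main T])
      (simp add: B_def Let_def coord_field_to_chart[OF A' d(1) Tc(2)])
  moreover have "B (snd c p) (?dv V u) (?v W (snd c p)) + B (snd c p) (?v V (snd c p)) (?dv W u)
       + C u (?v V (snd c p)) (?v W (snd c p)) =
      g (F p) (\<phi> (F p) (pullback_cov A A' nabla F p u V)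
          + g (F p) (mderiv A A' F p u) (V p) *\<^sub>R \<xi> (F p) - \<eta> (F p) (V p) *\<^sub>R mderiv A A' F p u) (W p)
      + g (F p) (\<phi> (F p) (V p)) (pullback_cov A A' nabla F p u W)" for u
    unfolding vp pullback_cov_def Let_def c_def[symmetric] d_def[symmetric]
    by (simp add: B_def C_def Let_def pc Ep linear_add[OF lin(1)] linear_add[OF lin(2)]
        linear_add[OF lin(3)] linear_diff[OF lin(1)])
  ultimately show ?thesis by simp
qed

lemma push_forward_components_differentiable:
  fixes F :: "'n::{t2_space,second_countable_topology} \<Rightarrow> 'b::{t2_space,second_countable_topology}"
    and A :: "('n, 'e::euclidean_space) chart set" and A' :: "('b, 'h::euclidean_space) chart set"
  assumes A: "smooth_atlas A" "smooth_atlas A'" and F: "smooth_map_on A A' UNIV F"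
    and c: "c \<in> A" "p \<in> fst c" and d: "d \<in> A'" "F p \<in> fst d"
    and Y: "open U" "p \<in> U" "smooth_field_on A U Y"
  shows "(\<lambda>x. to_chart A' d (F (chart_inv c x)) (mderiv A A' F (chart_inv c x) (Y (chart_inv c x))))
    differentiable (at (snd c p))"
proof -
  let ?S = "snd c ` (U \<inter> fst c \<inter> F -` fst d)"
  let ?F = "\<lambda>x. snd d (F (chart_inv c x))"
  have contF: "continuous_on U F"
    using F continuous_on_subset unfolding smooth_map_on_def by blast
  have o: "open ?S" using open_chart_domain(2)[OF A c(1) d(1) Y(1) contF] .
  have sF: "smooth_on ?S ?F"
    by (rule smooth_on_subset[of "snd c ` (fst c \<inter> F -` fst d)"])
      (use F c d in \<open>auto simp: smooth_map_on_def comp_def\<close>)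
  have sY: "smooth_on ?S (\<lambda>x. to_chart A c (chart_inv c x) (Y (chart_inv c x)))"
    by (rule smooth_on_subset[of "snd c ` (U \<inter> fst c)"])
      (use Y(3) c(1) in \<open>auto simp: smooth_field_on_def\<close>)
  have "smooth_on ?S (\<lambda>x. to_chart A' d (F (chart_inv c x)) (mderiv A A' F (chart_inv c x) (Y (chart_inv c x))))"
    by (rule smooth_on_eq[OF smooth_on_frechet_derivative[OF o sF sY] o])
      (auto simp: chart_inv_chart[OF A(1) c(1)] to_chart_mderiv[OF A open_UNIV F UNIV_I c(1) _ d(1)] local_deriv_def)
  then show ?thesis
    by (rule smooth_on_imp_differentiable[OF _ o]) (use Y c d in auto)
qed

section \<open>Orthogonal vectors in the range of the differential\<close>

text \<open>
  The geometric core. Let \<open>w = F\<^sub>* Y\<close> and \<open>z = F\<^sub>* X\<close> at \<open>p\<close>, with \<open>X\<close>, \<open>Y\<close> horizontal. In the derivative of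
  \<open>\<Omega> (F\<^sub>* Y) (F\<^sub>* X) = 0\<close> in the direction \<open>X\<close>, orthogonality of \<open>w\<close> and \<open>z\<close> removes the contribution of \<open>H\<close> to the
  first term, whereas the second one retains it with the factor \<open>g\<^sub>B z z > 0\<close>.
\<close>

lemma orthogonal_range_vectors:
  fixes F :: "'n::{t2_space,second_countable_topology} \<Rightarrow> 'b::{t2_space,second_countable_topology}"
    and A :: "('n, 'e::euclidean_space) chart set" and A' :: "('b, 'h::euclidean_space) chart set"
  assumes N: "riemannian_manifold A gN nablaN" and B: "sasakian_manifold A' \<phi> \<xi> \<eta> gB nablaB"
    and F: "riemannian_map A gN A' gB F" and anti: "anti_invariant A A' \<phi> gB F"
    and umb: "umbilical_map A gN nablaN A' nablaB F H"
    and reeb: "\<xi> (F p) \<in> orth gB (F p) (range_at A A' F p)"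
    and w: "w \<in> range_at A A' F p" and z: "z \<in> range_at A A' F p" "z \<noteq> 0" "gB (F p) z w = 0"
  shows "gB (F p) (\<phi> (F p) w) (H p) = 0"
proof -
  have A: "smooth_atlas A" "riemannian_metric A gN"
    using N unfolding riemannian_manifold_def by auto
  note A' = sasakian_props(1,2)[OF B]
  have Fs: "smooth_map_on A A' UNIV F" using F unfolding riemannian_map_def by blast
  let ?dF = "mderiv A A' F"
  obtain x y where x: "x \<in> horizontal A A' gN F p" "?dF p x = z"
    and y: "y \<in> horizontal A A' gN F p" "?dF p y = w"
  proof -
    have "?dF p ` horizontal A A' gN F p = range_at A A' F p"
      using F unfolding riemannian_map_def by simp
    then have "z \<in> ?dF p ` horizontal A A' gN F p" "w \<in> ?dF p ` horizontal A A' gN F p"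
      using w z(1) by simp_all
    then show thesis using that by blast
  qed
  obtain U1 X where X: "open U1" "p \<in> U1" "smooth_field_on A U1 X"
      "\<And>q. q \<in> U1 \<Longrightarrow> X q \<in> horizontal A A' gN F q" "X p = x"
    using horizontal_extension[OF A(1) A'(1) A(2) A'(2) F x(1)] by blast
  obtain U2 Y where Y: "open U2" "p \<in> U2" "smooth_field_on A U2 Y"
      "\<And>q. q \<in> U2 \<Longrightarrow> Y q \<in> horizontal A A' gN F q" "Y p = y"
    using horizontal_extension[OF A(1) A'(1) A(2) A'(2) F y(1)] by blast
  define U where "U = U1 \<inter> U2"
  have U: "open U" "p \<in> U" "smooth_field_on A U X" "smooth_field_on A U Y"
    using X Y smooth_field_on_subset[of A _ _ U] unfolding U_def by (auto intro: smooth_field_on_subset)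
  have iso: "gN p a b = gB (F p) (?dF p a) (?dF p b)"
    if "a \<in> horizontal A A' gN F p" "b \<in> horizontal A A' gN F p" for a b
    using F that unfolding riemannian_map_def by simp
  define c where "c = chart_at A p"
  define d where "d = chart_at A' (F p)"
  have c: "c \<in> A" "p \<in> fst c" and d: "d \<in> A'" "F p \<in> fst d"
    using chart_at_props[OF A(1)] chart_at_props[OF A'(1)] unfolding c_def d_def by auto
  let ?X = "\<lambda>q. ?dF q (X q)" and ?Y = "\<lambda>q. ?dF q (Y q)"
  let ?P = "\<lambda>W. pullback_cov A A' nablaB F p x W"
  have anti': "gB (F q) (\<phi> (F q) (?dF q a)) (?dF q b) = 0" for q a b
  proof -
    have "\<phi> (F q) (?dF q a) \<in> orth gB (F q) (range (?dF q))"
      using anti unfolding anti_invariant_def by blast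
    then show ?thesis unfolding orth_def by blast
  qed
  from fundamental_form_has_derivative_along[OF A(1) B Fs,
      OF push_forward_components_differentiable[OF A(1) A'(1) Fs c d U(1,2,4), unfolded c_def d_def]
        push_forward_components_differentiable[OF A(1) A'(1) Fs c d U(1,2,3), unfolded c_def d_def]]
  have "((\<lambda>x. 0) has_derivative (\<lambda>u.
      gB (F p) (\<phi> (F p) (pullback_cov A A' nablaB F p u ?Y)
          + gB (F p) (?dF p u) (?Y p) *\<^sub>R \<xi> (F p) - \<eta> (F p) (?Y p) *\<^sub>R ?dF p u) (?X p)
      + gB (F p) (\<phi> (F p) (?Y p)) (pullback_cov A A' nablaB F p u ?X))) (at (snd (chart_at A p) p))"
    by (simp add: anti')
  from has_derivative_unique[OF this has_derivative_const]
  have "gB (F p) (\<phi> (F p) (?P ?Y) + gB (F p) (?dF p x) (?Y p) *\<^sub>R \<xi> (F p) - \<eta> (F p) (?Y p) *\<^sub>R ?dF p x) (?X p)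
      + gB (F p) (\<phi> (F p) (?Y p)) (?P ?X) = 0"
    by metis
  moreover have "\<eta> (F p) w = 0"
    using reeb w metric_props(2)[OF A'(2)] unfolding sasakian_props(8)[OF B] orth_def by auto
  ultimately have eq: "gB (F p) (\<phi> (F p) (?P ?Y)) z + gB (F p) (\<phi> (F p) w) (?P ?X) = 0"
    using x y X(5) Y(5) z by simp
  have ff: "?P (\<lambda>q. ?dF q (Z q)) = ?dF p (nablaN p x Z) + gN p x (Z p) *\<^sub>R H p"
    if "Z = X \<or> Z = Y" for Z
  proof -
    have "second_fundamental_form A nablaN A' nablaB F X Z p = gN p (X p) (Z p) *\<^sub>R H p"
      using umb[unfolded umbilical_map_def, rule_format, of U X Z p] U that X(4) Y(4)
      unfolding U_def by auto
    then show ?thesis unfolding second_fundamental_form_def X(5) by (simp add: algebra_simps)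
  qed
  have lin: "linear (gB (F p) v)" for v
    using metric_props(1)[OF A'(2)] unfolding bilinear_def by auto
  have "?P ?Y = ?dF p (nablaN p x Y)"
    using ff[of Y] iso[OF x(1) y(1)] x y Y(5) z by simp
  then have "gB (F p) (\<phi> (F p) (?P ?Y)) z = 0"
    using anti' x(2) by metis
  moreover have "gB (F p) (\<phi> (F p) w) (?P ?X) = gB (F p) z z * gB (F p) (\<phi> (F p) w) (H p)"
    using ff[of X] iso[OF x(1) x(1)] anti'[of p y] x y X(5) by (simp add: linear_add[OF lin] linear_scale[OF lin])
  ultimately show ?thesis
    using eq metric_props(3)[OF A'(2) z(2), of "F p"] by simp
qed

lemma orthogonal_vector_in_subspace:
  assumes "riemannian_metric A g" "subspace R" "dim R \<noteq> 1" "w \<in> R" "w \<noteq> 0"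
  obtains z where "z \<in> R" "z \<noteq> 0" "g p z w = 0"
proof -
  have lin: "linear (\<lambda>u. g p u w)"
    using metric_props(1)[OF assms(1)] unfolding bilinear_def by auto
  have pos: "g p w w > 0" using metric_props(3)[OF assms(1,5)] .
  have "dim (span {w}) = 1" using assms(5) by (simp add: dim_insert)
  then have "\<not> R \<subseteq> span {w}"
    using assms(2-4) by (metis empty_subsetI insert_subset span_minimal subset_antisym)
  then obtain v where v: "v \<in> R" "v \<notin> span {w}" by blast
  let ?z = "v - (g p v w / g p w w) *\<^sub>R w"
  show thesis
  proof (rule that)
    show "?z \<in> R" using assms(2,4) v(1) subspace_diff subspace_scale by blast
    show "?z \<noteq> 0" using v(2) by (metis eq_iff_diff_eq_0 span_base span_scale singletonI)
    show "g p ?z w = 0" using pos by (simp add: linear_diff[OF lin] linear_scale[OF lin])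
  qed
qed

theorem theorem3p2:
  fixes AN :: "('n::{t2_space,second_countable_topology}, 'e::euclidean_space) chart set"
    and gN :: "'n \<Rightarrow> 'e \<Rightarrow> 'e \<Rightarrow> real"
    and nablaN :: "('n, 'e) cov"
    and AB :: "('b::{t2_space,second_countable_topology}, 'h::euclidean_space) chart set"
    and \<phi> :: "'b \<Rightarrow> 'h \<Rightarrow> 'h" and \<xi> :: "'b \<Rightarrow> 'h" and \<eta> :: "'b \<Rightarrow> 'h \<Rightarrow> real"
    and gB :: "'b \<Rightarrow> 'h \<Rightarrow> 'h \<Rightarrow> real"
    and nablaB :: "('b, 'h) cov"
    and F :: "'n \<Rightarrow> 'b" and f :: "'b \<Rightarrow> real"
  assumes N: "riemannian_manifold AN gN nablaN"
    and B: "sasakian_manifold AB \<phi> \<xi> \<eta> gB nablaB"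
    and F: "riemannian_map AN gN AB gB F"
    and anti: "anti_invariant AN AB \<phi> gB F"
    and f: "smooth_fun_on AB UNIV f"
    and clairaut: "clairaut_map AN AB gB nablaB F (\<lambda>b. exp (f b))"
    and meena_yadav: "clairaut_map AN AB gB nablaB F (\<lambda>b. exp (f b)) \<longleftrightarrow>
      umbilical_map AN gN nablaN AB nablaB F (\<lambda>p. - grad AB gB f (F p))"
    and reeb: "\<And>p. \<xi> (F p) \<in> orth gB (F p) (range_at AN AB F p)"
    and geodesic: "totally_geodesic_normal AN AB gB nablaB F"
  shows "(\<forall>p. dim (range_at AN AB F p) = 1) \<or>
    (\<forall>p. \<forall>w\<in>range_at AN AB F p. gB (F p) (grad AB gB f (F p)) (\<phi> (F p) w) = 0)"
proof (rule disjCI)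
  assume "\<not> (\<forall>p. \<forall>w\<in>range_at AN AB F p. gB (F p) (grad AB gB f (F p)) (\<phi> (F p) w) = 0)"
  then obtain p w where w: "w \<in> range_at AN AB F p"
      "gB (F p) (grad AB gB f (F p)) (\<phi> (F p) w) \<noteq> 0"
    by blast
  note AB = sasakian_props(1,2)[OF B]
  have AN: "smooth_atlas AN" using N unfolding riemannian_manifold_def by blast
  have umb: "umbilical_map AN gN nablaN AB nablaB F (\<lambda>p. - grad AB gB f (F p))"
    using clairaut meena_yadav by blast
  have lin: "linear (gB (F p) v)" for v
    using metric_props(1)[OF AB(2)] unfolding bilinear_def by auto
  have "w \<noteq> 0"
    using w(2) linear_0[OF sasakian_props(5)[OF B]] linear_0[OF lin] by auto
  have "dim (range_at AN AB F p) = 1"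
  proof (rule ccontr)
    assume dim: "dim (range_at AN AB F p) \<noteq> 1"
    have "smooth_map_on AN AB UNIV F" using F unfolding riemannian_map_def by blast
    then have "subspace (range_at AN AB F p)"
      using linear_mderiv[OF AN AB(1) open_UNIV] linear_subspace_image subspace_UNIV by blast
    then obtain z where z: "z \<in> range_at AN AB F p" "z \<noteq> 0" "gB (F p) z w = 0"
      using orthogonal_vector_in_subspace[OF AB(2) _ dim w(1) \<open>w \<noteq> 0\<close>] by metis
    have "gB (F p) (\<phi> (F p) w) (- grad AB gB f (F p)) = 0"
      by (rule orthogonal_range_vectors[OF N B F anti umb reeb w(1) z])
    then show False
      using w(2) metric_props(2)[OF AB(2)] linear_neg[OF lin] by simp
  qed
  moreover obtain k where "\<And>q. dim (range_at AN AB F q) = k"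
    using F unfolding riemannian_map_def by blast
  ultimately show "\<forall>p. dim (range_at AN AB F p) = 1" by simp
qed

end
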